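(* For every $k\ge1$ there are constants $c_1,c_2>0$ such that the following holds. For every $n\ge 2k$ and every family $\mathcal F$ of weighted $k$-uniform hypergraphs with vertex set $[n]$ such that $w([n])=0$ for all $w\in\mathcal F$, there is a partition $\mathcal F=\mathcal F_1\cup\cdots\cup\mathcal F_k$ (parts possibly empty) such that, for every $1\le i\le k$ and all distinct $w,u\in \mathcal F_i$, $$\operatorname{disc}(w,u) \ge c_1 \|w\|_1\|u\|_1/n^{i/2-1/2+k}$$ and $$\mathbb{E}_\pi|\langle w_\pi,u\rangle|\ge c_2\|w\|_1\|u\|_1/n^{i/2+k},$$ where $\pi$ is a uniformly random permutation of $[n]$.
   Context: $[n]=\{1,\dots,n\}$; $V^{(k)}$ is the family of $k$-subsets of $V$. A weighted $k$-uniform hypergraph on $V$ is a function $w:V^{(k)}\to\mathbb{R}$; $w(S)=\sum_{e\in S^{(k)}}w(e)$, $\|w\|_1=\sum_e|w(e)|$, $\langle w,u\rangle=\sum_{e}w(e)u(e)$, $d(w)=w(V)/\binom{|V|}k$, and $w_\pi(e)=w(\pi^{-1}(e))$ for a permutation $\pi$ of $V$. With $n=|V|$, $\operatorname{disc}(w,u)=\max_\pi|\langle w_\pi,u\rangle-d(w)d(u)\binom nk|$ over all permutations $\pi$ of $V$. *)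

theory Defs
  imports "HOL-Analysis.Analysis" "HOL-Combinatorics.Permutations"
begin

definition ksubsets :: "'a set \<Rightarrow> nat \<Rightarrow> 'a set set" where
  "ksubsets V k = {S. S \<subseteq> V \<and> card S = k}"

text \<open>A weighted k-uniform hypergraph on [n] is represented by a function on sets
  of naturals that vanishes outside the k-subsets of [n].\<close>
definition is_whyp :: "nat \<Rightarrow> nat \<Rightarrow> (nat set \<Rightarrow> real) \<Rightarrow> bool" where
  "is_whyp n k w \<longleftrightarrow> (\<forall>e. e \<notin> ksubsets {1..n} k \<longrightarrow> w e = 0)"

definition hweight :: "nat \<Rightarrow> (nat set \<Rightarrow> real) \<Rightarrow> nat set \<Rightarrow> real" where
  "hweight k w S = (\<Sum>e\<in>ksubsets S k. w e)"

definition hnorm1 :: "nat \<Rightarrow> nat \<Rightarrow> (nat set \<Rightarrow> real) \<Rightarrow> real" where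
  "hnorm1 n k w = (\<Sum>e\<in>ksubsets {1..n} k. \<bar>w e\<bar>)"

definition hinner :: "nat \<Rightarrow> nat \<Rightarrow> (nat set \<Rightarrow> real) \<Rightarrow> (nat set \<Rightarrow> real) \<Rightarrow> real" where
  "hinner n k w u = (\<Sum>e\<in>ksubsets {1..n} k. w e * u e)"

definition hdensity :: "nat \<Rightarrow> nat \<Rightarrow> (nat set \<Rightarrow> real) \<Rightarrow> real" where
  "hdensity n k w = hweight k w {1..n} / real (n choose k)"

definition hperm :: "(nat \<Rightarrow> nat) \<Rightarrow> (nat set \<Rightarrow> real) \<Rightarrow> (nat set \<Rightarrow> real)" where
  "hperm \<pi> w = (\<lambda>e. w (inv \<pi> ` e))"

definition disc :: "nat \<Rightarrow> nat \<Rightarrow> (nat set \<Rightarrow> real) \<Rightarrow> (nat set \<Rightarrow> real) \<Rightarrow> real" where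
  "disc n k w u = Max ((\<lambda>\<pi>. \<bar>hinner n k (hperm \<pi> w) u
        - hdensity n k w * hdensity n k u * real (n choose k)\<bar>) ` {\<pi>. \<pi> permutes {1..n}})"

definition exp_abs_inner :: "nat \<Rightarrow> nat \<Rightarrow> (nat set \<Rightarrow> real) \<Rightarrow> (nat set \<Rightarrow> real) \<Rightarrow> real" where
  "exp_abs_inner n k w u =
     (\<Sum>\<pi>\<in>{\<pi>. \<pi> permutes {1..n}}. \<bar>hinner n k (hperm \<pi> w) u\<bar>) / fact n"

end

theory Submission
  imports Defs "HOL-Computational_Algebra.Polynomial"
begin

text \<open>Write a random permutation as \<open>\<beta> \<circ> \<tau> \<circ> inv \<sigma>\<close>, where \<open>\<sigma>\<close> and \<open>\<beta>\<close> are uniformly random and \<open>\<tau>\<close>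
  swaps a random subset of the pairs \<open>{l, m + l}\<close>, \<open>m = n div 2\<close>. For fixed \<open>\<sigma>\<close> and \<open>\<beta>\<close> the inner product
  is a polynomial of degree at most \<open>k\<close> in the \<open>m\<close> random signs. By Bonami's inequality its mean
  absolute value is at least a constant times \<open>n powr (- i / 2)\<close> times the sum of the absolute values of the
  coefficients of level \<open>i\<close>; choosing part of the signs greedily, its maximum gains a factor \<open>sqrt n\<close>.
  By convexity the mean absolute value of a coefficient of level \<open>i\<close> is at least the product of the
  quantities \<open>A\<^sub>i(w) = E |\<Sum>\<^sub>f \<plusminus>w(f)|\<close> of the two hypergraphs, the sum being over the \<open>k\<close>-sets \<open>f\<close> that
  cross \<open>i\<close> random disjoint pairs, divided by the number of such \<open>f\<close>. Replacing vertices by pairs one at a time bounds the norm of a hypergraph of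
  total weight \<open>0\<close> by a constant times \<open>\<Sum>\<^sub>i n\<^sup>i A\<^sub>i(w)\<close>, \<open>1 \<le> i \<le> k\<close>; a hypergraph is put into a part whose
  index \<open>i\<close> contributes a constant fraction.\<close>

section \<open>Low-degree polynomials in random signs\<close>

text \<open>A sign vector is encoded by the set \<open>e\<close> of its coordinates equal to -1, so
  \<open>walsh S e\<close> is the monomial of the signs indexed by \<open>S\<close>.\<close>

definition walsh :: "'a set \<Rightarrow> 'a set \<Rightarrow> real" where
  "walsh S e = (\<Prod>l\<in>S. if l \<in> e then - 1 else 1)"

definition wpoly :: "'a set \<Rightarrow> ('a set \<Rightarrow> real) \<Rightarrow> 'a set \<Rightarrow> real" where
  "wpoly M c e = (\<Sum>S\<in>Pow M. c S * walsh S e)"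

lemma sum_Pow_insert:
  fixes g :: "'a set \<Rightarrow> 'b::comm_monoid_add"
  assumes "finite M" "a \<notin> M"
  shows "(\<Sum>S\<in>Pow (insert a M). g S) = (\<Sum>S\<in>Pow M. g S + g (insert a S))"
proof -
  have "inj_on (insert a) (Pow M)"
    using assms by (auto simp: inj_on_def)
  then have "(\<Sum>S\<in>insert a ` Pow M. g S) = (\<Sum>S\<in>Pow M. g (insert a S))"
    by (simp add: sum.reindex)
  moreover have "Pow M \<inter> insert a ` Pow M = {}"
    using assms by auto
  ultimately show ?thesis
    using assms by (simp add: Pow_insert sum.union_disjoint sum.distrib)
qed

lemma walsh_insert_left:
  assumes "finite S" "a \<notin> S"
  shows "walsh (insert a S) e = (if a \<in> e then - 1 else 1) * walsh S e"
  using assms by (simp add: walsh_def)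

lemma walsh_insert_right:
  assumes "a \<notin> S"
  shows "walsh S (insert a e) = walsh S e"
  unfolding walsh_def using assms by (intro prod.cong) auto

lemma wpoly_insert:
  assumes "finite M" "a \<notin> M"
  shows "wpoly (insert a M) c e =
    wpoly M c e + (if a \<in> e then - 1 else 1) * wpoly M (\<lambda>S. c (insert a S)) e"
proof -
  have "walsh (insert a S) e = (if a \<in> e then - 1 else 1) * walsh S e" if "S \<in> Pow M" for S
    using that assms by (intro walsh_insert_left) (auto intro: finite_subset)
  then show ?thesis
    unfolding wpoly_def using assms
    by (simp add: sum_Pow_insert sum.distrib sum_distrib_left)
qed

lemma wpoly_insert_right:
  assumes "a \<notin> M"
  shows "wpoly M c (insert a e) = wpoly M c e"
  unfolding wpoly_def using assms
  by (intro sum.cong refl arg_cong2[of _ _ _ _ "(*)"] walsh_insert_right) auto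

text \<open>The moment inductions below rest on this: summing out the sign of \<open>a\<close>
  leaves the values \<open>A + B\<close> and \<open>A - B\<close>, where \<open>B\<close> collects
  the monomials containing \<open>a\<close>.\<close>

lemma sum_wpoly_insert:
  fixes h :: "real \<Rightarrow> real"
  assumes "finite M" "a \<notin> M"
  shows "(\<Sum>e\<in>Pow (insert a M). h (wpoly (insert a M) c e)) =
    (\<Sum>e\<in>Pow M. h (wpoly M c e + wpoly M (\<lambda>S. c (insert a S)) e)
                 + h (wpoly M c e - wpoly M (\<lambda>S. c (insert a S)) e))"
  unfolding sum_Pow_insert[OF assms]
  using assms by (intro sum.cong refl) (auto simp: wpoly_insert wpoly_insert_right)

section \<open>Moments of low-degree polynomials\<close>

lemma parseval_wpoly:
  assumes "finite M"
  shows "(\<Sum>e\<in>Pow M. (wpoly M c e)\<^sup>2) = 2 ^ card M * (\<Sum>S\<in>Pow M. (c S)\<^sup>2)"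
  using assms
proof (induction M arbitrary: c)
  case empty
  then show ?case by (simp add: wpoly_def walsh_def)
next
  case (insert a M)
  have eq: "(x + y)\<^sup>2 + (x - y)\<^sup>2 = 2 * (x\<^sup>2 + y\<^sup>2)" for x y :: real
    by (simp add: power2_eq_square algebra_simps)
  show ?case
    unfolding sum_wpoly_insert[OF insert.hyps(1,2), of "\<lambda>x. x\<^sup>2"] eq
      sum_distrib_left[symmetric] sum.distrib insert.IH sum_Pow_insert[OF insert.hyps(1,2)]
    using insert.hyps by (simp add: algebra_simps)
qed

text \<open>The hypercontractive inequality between second and fourth moments. When one sign is
  summed out, the odd powers of \<open>B\<close> cancel; \<open>B\<close> has degree one less, and
  only the mixed second moment remains to be estimated, by Cauchy-Schwarz.\<close>

lemma bonami_fourth_moment: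
  assumes "finite M" "\<And>S. S \<subseteq> M \<Longrightarrow> k < card S \<Longrightarrow> c S = 0"
  shows "(\<Sum>e\<in>Pow M. (wpoly M c e) ^ 4) \<le> 2 ^ card M * 9 ^ k * (\<Sum>S\<in>Pow M. (c S)\<^sup>2)\<^sup>2"
  using assms
proof (induction M arbitrary: c k)
  case empty
  have "(1::real) \<le> 9 ^ k" by simp
  moreover have "0 \<le> (c {}) ^ 4" by simp
  ultimately have "1 * (c {}) ^ 4 \<le> 9 ^ k * (c {}) ^ 4"
    by (intro mult_right_mono)
  then show ?case by (simp add: wpoly_def walsh_def)
next
  case (insert a M)
  define c' where "c' = (\<lambda>S. c (insert a S))"
  define A where "A = wpoly M c"
  define B where "B = wpoly M c'"
  define p where "p = (\<Sum>S\<in>Pow M. (c S)\<^sup>2)"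
  define q where "q = (\<Sum>S\<in>Pow M. (c' S)\<^sup>2)"
  define N where "N = (2::real) ^ card M"
  have N0: "N \<ge> 0" and p0: "p \<ge> 0" and q0: "q \<ge> 0"
    by (auto simp: N_def p_def q_def intro!: sum_nonneg)
  have IA: "(\<Sum>e\<in>Pow M. A e ^ 4) \<le> N * 9 ^ k * p\<^sup>2"
    unfolding A_def N_def p_def using insert.IH[of k c] insert.prems by auto
  have eq: "(x + y) ^ 4 + (x - y) ^ 4 = 2 * (x ^ 4 + 6 * (x\<^sup>2 * y\<^sup>2) + y ^ 4)" for x y :: real
    by (simp add: power2_eq_square power4_eq_xxxx algebra_simps)
  have S: "(\<Sum>e\<in>Pow (insert a M). (wpoly (insert a M) c e) ^ 4) =
      2 * ((\<Sum>e\<in>Pow M. A e ^ 4) + 6 * (\<Sum>e\<in>Pow M. (A e)\<^sup>2 * (B e)\<^sup>2) + (\<Sum>e\<in>Pow M. B e ^ 4))"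
    unfolding sum_wpoly_insert[OF insert.hyps(1,2), of "\<lambda>x. x ^ 4"] eq
      sum_distrib_left[symmetric] sum.distrib A_def B_def c'_def ..
  have R: "(\<Sum>S\<in>Pow (insert a M). (c S)\<^sup>2) = p + q"
    using insert.hyps by (simp add: sum_Pow_insert sum.distrib p_def q_def c'_def)
  have card: "2 ^ card (insert a M) = 2 * N"
    using insert.hyps by (simp add: N_def)
  show ?case
  proof (cases k)
    case 0
    \<comment> \<open>Degree 0 leaves no monomial containing \<open>a\<close>.\<close>
    have c0: "c' S = 0" if "S \<in> Pow M" for S
      using that insert.prems[of "insert a S"] insert.hyps 0 finite_subset[of S M]
      by (auto simp: c'_def card_gt_0_iff)
    then have "B e = 0" for e
      by (simp add: B_def wpoly_def)
    moreover have "q = 0"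
      using c0 by (simp add: q_def)
    ultimately show ?thesis
      unfolding S R card using IA by simp
  next
    case (Suc j)
    have IB: "(\<Sum>e\<in>Pow M. B e ^ 4) \<le> N * 9 ^ j * q\<^sup>2"
      unfolding B_def N_def q_def
    proof (rule insert.IH)
      fix S assume "S \<subseteq> M" "j < card S"
      moreover from this have "a \<notin> S" using insert.hyps by auto
      ultimately show "c' S = 0"
        using insert.prems[of "insert a S"] insert.hyps Suc finite_subset[of S M]
        by (auto simp: c'_def card_insert_if)
    qed
    have "(\<Sum>e\<in>Pow M. (A e)\<^sup>2 * (B e)\<^sup>2)\<^sup>2 \<le>
        (\<Sum>e\<in>Pow M. ((A e)\<^sup>2)\<^sup>2) * (\<Sum>e\<in>Pow M. ((B e)\<^sup>2)\<^sup>2)"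
      by (rule Cauchy_Schwarz_ineq_sum)
    also have "\<dots> = (\<Sum>e\<in>Pow M. A e ^ 4) * (\<Sum>e\<in>Pow M. B e ^ 4)"
      by (simp add: power_mult[symmetric])
    also have "\<dots> \<le> (N * 9 ^ k * p\<^sup>2) * (N * 9 ^ j * q\<^sup>2)"
      using IA IB N0 by (intro mult_mono) (auto intro!: sum_nonneg)
    also have "\<dots> = (3 * N * 9 ^ j * p * q)\<^sup>2"
      unfolding Suc by (simp add: power2_eq_square)
    finally have "(\<Sum>e\<in>Pow M. (A e)\<^sup>2 * (B e)\<^sup>2) \<le> 3 * N * 9 ^ j * p * q"
      by (rule power2_le_imp_le) (use N0 p0 q0 in auto)
    moreover have "N * 9 ^ j * q\<^sup>2 \<le> N * 9 ^ k * q\<^sup>2"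
      unfolding Suc using N0 by (intro mult_right_mono mult_left_mono) auto
    ultimately have "(\<Sum>e\<in>Pow (insert a M). (wpoly (insert a M) c e) ^ 4) \<le>
        2 * (N * 9 ^ k * p\<^sup>2 + 6 * (3 * N * 9 ^ j * p * q) + N * 9 ^ k * q\<^sup>2)"
      unfolding S using order_trans[OF IB] by (intro mult_left_mono add_mono IA) auto
    \<comment> \<open>Since \<open>6 * 3 * 9 ^ j = 2 * 9 ^ k\<close>, the mixed term exactly
      completes the square; this fixes the constant 9.\<close>
    also have "\<dots> = 2 * N * 9 ^ k * (p + q)\<^sup>2"
      unfolding Suc by (simp add: power2_eq_square algebra_simps)
    finally show ?thesis
      unfolding R card .
  qed
qed

text \<open>Reverses the trivial comparison of first and second moments. Low degree enters through
  the fourth moment, which prevents the second moment from coming from a few rare large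
  values.\<close>

lemma first_moment_wpoly:
  assumes M: "finite M" and c: "\<And>S. S \<subseteq> M \<Longrightarrow> k < card S \<Longrightarrow> c S = 0"
  shows "2 ^ card M * sqrt (\<Sum>S\<in>Pow M. (c S)\<^sup>2) \<le> 3 ^ Suc k * (\<Sum>e\<in>Pow M. \<bar>wpoly M c e\<bar>)"
proof (cases "(\<Sum>S\<in>Pow M. (c S)\<^sup>2) = 0")
  case True
  then show ?thesis by (simp add: sum_nonneg)
next
  case False
  define q where "q = (\<Sum>S\<in>Pow M. (c S)\<^sup>2)"
  define r where "r = sqrt q"
  define s where "s = 2 * 3 ^ k * r"
  define P where "P = wpoly M c"
  define N where "N = (2::real) ^ card M"
  have "q > 0"
    using False sum_nonneg[of "Pow M" "\<lambda>S. (c S)\<^sup>2"] by (simp add: q_def)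
  then have r: "r > 0" "r\<^sup>2 = q" and s: "s > 0"
    by (auto simp: r_def s_def)
  have N: "N > 0" by (simp add: N_def)
  \<comment> \<open>Scaled form of \<open>y \<ge> y\<^sup>2 - y\<^sup>4\<close>; it replaces Hoelder's inequality, and \<open>s\<close> balances
    the second against the fourth moment.\<close>
  have pt: "\<bar>x\<bar> \<ge> x\<^sup>2 / s - x ^ 4 / s ^ 3" for x
  proof -
    define y where "y = \<bar>x\<bar> / s"
    have y0: "y \<ge> 0" using s by (simp add: y_def)
    have "y\<^sup>2 - y ^ 4 \<le> y"
    proof (cases "y \<le> 1")
      case True
      then have "y\<^sup>2 \<le> y" using y0 by (simp add: power2_eq_square mult_left_le)
      then show ?thesis using zero_le_power[OF y0, of 4] by linarith
    next
      case False
      then have "y ^ 2 \<le> y ^ 4" by (intro power_increasing) auto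
      then show ?thesis using y0 by linarith
    qed
    then have "s * (y\<^sup>2 - y ^ 4) \<le> s * y" using s by (intro mult_left_mono) auto
    moreover have "s * y = \<bar>x\<bar>" using s by (simp add: y_def)
    moreover have "s * (y\<^sup>2 - y ^ 4) = x\<^sup>2 / s - x ^ 4 / s ^ 3"
      using s by (simp add: y_def power_divide field_simps power_even_abs power2_eq_square power3_eq_cube power4_eq_xxxx)
    ultimately show ?thesis by simp
  qed
  have "(\<Sum>e\<in>Pow M. (P e) ^ 4) / s ^ 3 \<le> N * 9 ^ k * q\<^sup>2 / s ^ 3"
    unfolding P_def N_def q_def using s
    by (intro divide_right_mono bonami_fourth_moment M c) auto
  also have "\<dots> = N * r / (8 * 3 ^ k)"
  proof -
    have "(9::real) ^ k = 3 ^ k * 3 ^ k"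
      by (simp add: power_mult_distrib[symmetric])
    then show ?thesis
      unfolding s_def r(2)[symmetric] using r(1)
      by (simp add: field_simps power2_eq_square power3_eq_cube)
  qed
  finally have 4: "(\<Sum>e\<in>Pow M. (P e) ^ 4) / s ^ 3 \<le> N * r / (8 * 3 ^ k)" .
  have 2: "(\<Sum>e\<in>Pow M. (P e)\<^sup>2) / s = N * r / (2 * 3 ^ k)"
    unfolding P_def parseval_wpoly[OF M] q_def[symmetric] N_def[symmetric] s_def r(2)[symmetric]
    using r(1) by (simp add: field_simps power2_eq_square)
  have "(\<Sum>e\<in>Pow M. (P e)\<^sup>2 / s - (P e) ^ 4 / s ^ 3) \<le> (\<Sum>e\<in>Pow M. \<bar>P e\<bar>)"
    by (intro sum_mono pt)
  then have "N * r / (2 * 3 ^ k) - N * r / (8 * 3 ^ k) \<le> (\<Sum>e\<in>Pow M. \<bar>P e\<bar>)"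
    using 4 2 by (simp add: sum_subtractf sum_divide_distrib[symmetric])
  moreover have "N * r / (2 * 3 ^ k) - N * r / (8 * 3 ^ k) = 3 * (N * r) / (8 * 3 ^ k)"
    by simp
  \<comment> \<open>The balance \<open>1 / 2 - 1 / 8 = 3 / 8\<close> is weakened to
    \<open>1 / 3\<close>.\<close>
  moreover have "N * r / (3 ^ Suc k) \<le> 3 * (N * r) / (8 * 3 ^ k)"
    using N r by (simp add: field_simps)
  ultimately have "N * r / (3 ^ Suc k) \<le> (\<Sum>e\<in>Pow M. \<bar>P e\<bar>)"
    by linarith
  then show ?thesis
    by (simp add: P_def N_def r_def q_def field_simps)
qed

text \<open>Cauchy-Schwarz over one level, which has at most \<open>n ^ i\<close> sets and so costs
  the square root of that number.\<close>

lemma sum_abs_level_le: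
  assumes "finite M" "card M \<le> n"
  shows "(\<Sum>S | S \<subseteq> M \<and> card S = i. \<bar>c S\<bar>) \<le> sqrt (real n) ^ i * sqrt (\<Sum>S\<in>Pow M. (c S)\<^sup>2)"
proof -
  define L where "L = {S. S \<subseteq> M \<and> card S = i}"
  have fin: "finite L" and sub: "L \<subseteq> Pow M"
    using assms by (auto simp: L_def)
  have "card L = card M choose i"
    unfolding L_def using assms by (simp add: n_subsets)
  also have "\<dots> \<le> card M ^ i"
    by (cases "i \<le> card M") (auto simp: binomial_le_pow binomial_eq_0)
  also have "\<dots> \<le> n ^ i"
    using assms by (simp add: power_mono)
  finally have L: "real (card L) \<le> real n ^ i"
    by (metis of_nat_le_iff of_nat_power)
  have "(\<Sum>S\<in>L. 1 * \<bar>c S\<bar>)\<^sup>2 \<le> (\<Sum>S\<in>L. 1\<^sup>2) * (\<Sum>S\<in>L. \<bar>c S\<bar>\<^sup>2)"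
    by (rule Cauchy_Schwarz_ineq_sum)
  also have "\<dots> \<le> real n ^ i * (\<Sum>S\<in>Pow M. (c S)\<^sup>2)"
    using L sub assms by (intro mult_mono) (auto intro!: sum_nonneg sum_mono2)
  also have "\<dots> = (sqrt (real n) ^ i * sqrt (\<Sum>S\<in>Pow M. (c S)\<^sup>2))\<^sup>2"
    by (simp add: power_mult_distrib sum_nonneg power_mult[symmetric] mult.commute[of i] power_mult)
  finally show ?thesis
    unfolding L_def[symmetric]
    by (simp only: mult_1) (rule power2_le_imp_le, auto intro!: mult_nonneg_nonneg sum_nonneg)
qed

lemma first_moment_wpoly_level:
  assumes M: "finite M" "card M \<le> n" and c: "\<And>S. S \<subseteq> M \<Longrightarrow> k < card S \<Longrightarrow> c S = 0"
  shows "2 ^ card M * (\<Sum>S | S \<subseteq> M \<and> card S = i. \<bar>c S\<bar>)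
    \<le> sqrt (real n) ^ i * 3 ^ Suc k * (\<Sum>e\<in>Pow M. \<bar>wpoly M c e\<bar>)"
proof -
  have "2 ^ card M * (\<Sum>S | S \<subseteq> M \<and> card S = i. \<bar>c S\<bar>)
      \<le> 2 ^ card M * (sqrt (real n) ^ i * sqrt (\<Sum>S\<in>Pow M. (c S)\<^sup>2))"
    by (intro mult_left_mono sum_abs_level_le M) auto
  also have "\<dots> = sqrt (real n) ^ i * (2 ^ card M * sqrt (\<Sum>S\<in>Pow M. (c S)\<^sup>2))"
    by simp
  also have "\<dots> \<le> sqrt (real n) ^ i * (3 ^ Suc k * (\<Sum>e\<in>Pow M. \<bar>wpoly M c e\<bar>))"
    by (intro mult_left_mono first_moment_wpoly M(1) c) auto
  finally show ?thesis by simp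
qed

section \<open>Linear coefficients and the maximum over sign vectors\<close>

text \<open>A multilinear function is affine in each coordinate, so on the cube it is bounded by its
  values at the vertices. The induction fixes \<open>x a\<close> and absorbs it into the
  coefficients of the remaining polynomial.\<close>

lemma multilinear_bound:
  assumes "finite M" "\<And>e. e \<subseteq> M \<Longrightarrow> \<bar>wpoly M c e\<bar> \<le> B" "\<And>l. l \<in> M \<Longrightarrow> \<bar>x l\<bar> \<le> 1"
  shows "\<bar>\<Sum>S\<in>Pow M. c S * (\<Prod>l\<in>S. x l)\<bar> \<le> B"
  using assms
proof (induction M arbitrary: c)
  case empty
  then show ?case by (simp add: wpoly_def walsh_def)
next
  case (insert a M)
  define c' where "c' = (\<lambda>S. c (insert a S))"
  have eq: "wpoly M (\<lambda>S. c S + x a * c' S) e = wpoly M c e + x a * wpoly M c' e" for e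
    by (simp add: wpoly_def sum_distrib_left sum.distrib algebra_simps)
  have "\<bar>\<Sum>S\<in>Pow M. (c S + x a * c' S) * (\<Prod>l\<in>S. x l)\<bar> \<le> B"
  proof (rule insert.IH)
    fix e assume e: "e \<subseteq> M"
    then have "a \<notin> e" using insert.hyps by auto
    then have "\<bar>wpoly M c e + wpoly M c' e\<bar> \<le> B" "\<bar>wpoly M c e - wpoly M c' e\<bar> \<le> B"
      using insert.prems(1)[of e] insert.prems(1)[of "insert a e"] e insert.hyps
      by (auto simp: wpoly_insert wpoly_insert_right c'_def)
    moreover have "\<bar>x a * wpoly M c' e\<bar> \<le> \<bar>wpoly M c' e\<bar>"
      using insert.prems(2)[of a] by (simp add: abs_mult mult_left_le_one_le)
    ultimately show "\<bar>wpoly M (\<lambda>S. c S + x a * c' S) e\<bar> \<le> B"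
      unfolding eq by linarith
  qed (use insert.prems in auto)
  moreover have "(\<Prod>l\<in>insert a S. x l) = x a * (\<Prod>l\<in>S. x l)" if "S \<in> Pow M" for S
    using that insert.hyps by (subst prod.insert) (auto intro: finite_subset)
  ultimately show ?case
    using insert.hyps by (simp add: sum_Pow_insert c'_def algebra_simps)
qed

text \<open>A Markov-type inequality for the derivative at 0, with a constant depending on
  \<open>k\<close> alone, proved by lowering the degree.\<close>

lemma linear_coeff_bound:
  "\<exists>C>0. \<forall>(p::real poly) B. degree p \<le> k \<longrightarrow> (\<forall>b\<in>{0..1/2}. \<bar>poly p b\<bar> \<le> B) \<longrightarrow> \<bar>coeff p 1\<bar> \<le> C * B"
proof (induction k rule: nat_induct)
  case 0
  have "\<bar>coeff p 1\<bar> \<le> 1 * B" if "degree p \<le> 0" "\<forall>b\<in>{0..1/2}. \<bar>poly p b\<bar> \<le> B" for p :: "real poly" and B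
    using that(2)[rule_format, of 0] that(1) by (simp add: coeff_eq_0)
  then show ?case by (intro exI[of _ 1]) auto
next
  case (Suc k)
  show ?case
  \<comment> \<open>In degree one the elimination below would kill the linear coefficient too, its
    factor being \<open>1 - 2 ^ k\<close>. There the coefficient is twice the difference of the
    endpoint values, hence at most \<open>4 * B\<close>.\<close>
  proof (cases "k = 0")
    case True
    have "\<bar>coeff p 1\<bar> \<le> 4 * B" if p: "degree p \<le> Suc k" "\<forall>b\<in>{0..1/2}. \<bar>poly p b\<bar> \<le> B" for p :: "real poly" and B
    proof -
      have "p = [:coeff p 0, coeff p 1:]"
        using p(1) True by (intro poly_eqI) (auto simp: coeff_pCons coeff_eq_0 split: nat.split)
      then have "poly p b = coeff p 0 + coeff p 1 * b" for b
        by (metis poly_pCons poly_0 mult_zero_right add_0_right mult.commute)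
      then show ?thesis
        using p(2)[rule_format, of 0] p(2)[rule_format, of "1/2"] by simp
    qed
    then show ?thesis by (intro exI[of _ 4]) auto
  next
    case False
    obtain C where C: "C > 0" "\<And>(p::real poly) B. degree p \<le> k \<Longrightarrow> (\<forall>b\<in>{0..1/2}. \<bar>poly p b\<bar> \<le> B) \<Longrightarrow> \<bar>coeff p 1\<bar> \<le> C * B"
      using Suc by blast
    have "\<bar>coeff p 1\<bar> \<le> C * (1 + 2 ^ Suc k) * B"
      if p: "degree p \<le> Suc k" "\<forall>b\<in>{0..1/2}. \<bar>poly p b\<bar> \<le> B" for p :: "real poly" and B
    proof -
      \<comment> \<open>This combination kills the top coefficient and keeps a fixed multiple of the linear one.\<close>
      define q where "q = p - smult (2 ^ Suc k) (pcompose p [:0, 1/2:])"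
      have cq: "coeff q i = coeff p i * (1 - 2 ^ Suc k * (1/2) ^ i)" for i
        by (simp add: q_def coeff_pcompose_linear algebra_simps)
      have "coeff q i = 0" if "i > k" for i
      proof (cases "i = Suc k")
        case True
        then show ?thesis by (simp add: cq power_one_over)
      next
        case False
        then show ?thesis using that p(1) by (simp add: cq coeff_eq_0)
      qed
      then have "degree q \<le> k"
        by (intro degree_le) auto
      moreover have "\<bar>poly q b\<bar> \<le> (1 + 2 ^ Suc k) * B" if "b \<in> {0..1/2}" for b
      proof -
        have "\<bar>poly p b\<bar> \<le> B" "\<bar>poly p (b/2)\<bar> \<le> B"
          using p(2) that by auto
        moreover have "poly q b = poly p b - 2 ^ Suc k * poly p (b / 2)"
          by (simp add: q_def poly_pcompose)
        moreover have "\<bar>2 ^ Suc k * poly p (b / 2)\<bar> \<le> 2 ^ Suc k * B"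
          unfolding abs_mult using calculation by (intro mult_mono) auto
        ultimately show ?thesis
          by (simp only: distrib_right)
      qed
      ultimately have *: "\<bar>coeff q 1\<bar> \<le> C * ((1 + 2 ^ Suc k) * B)"
        using C(2) by blast
      have "(2::real) ^ k \<ge> 2 ^ 1"
        using False by (intro power_increasing) auto
      then have "1 \<le> \<bar>1 - 2 ^ Suc k * (1/2::real) ^ 1\<bar>"
        by simp
      then have "\<bar>coeff p 1\<bar> * 1 \<le> \<bar>coeff q 1\<bar>"
        unfolding cq abs_mult by (intro mult_left_mono) auto
      with * show ?thesis by (simp add: mult.assoc)
    qed
    then show ?thesis
      using C(1) by (intro exI[of _ "C * (1 + 2 ^ Suc k)"]) (auto intro!: mult_pos_pos add_pos_pos)
  qed
qed

lemma coeff_0_prod_linear: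
  "finite S \<Longrightarrow> coeff (\<Prod>l\<in>S. [:y l, s l:]) 0 = (\<Prod>l\<in>S. y l :: real)"
  by (induction S rule: finite_induct) auto

lemma coeff_1_prod_linear:
  "finite S \<Longrightarrow> coeff (\<Prod>l\<in>S. [:y l, s l:]) 1 = (\<Sum>l\<in>S. s l * (\<Prod>j\<in>S - {l}. y j :: real))"
proof (induction S rule: finite_induct)
  case (insert a S)
  have "(\<Prod>j\<in>insert a S - {l}. y j) = y a * (\<Prod>j\<in>S - {l}. y j)" if "l \<in> S" for l
  proof -
    have "insert a S - {l} = insert a (S - {l})" using that insert.hyps by auto
    then show ?thesis using insert.hyps by simp
  qed
  then have "(\<Sum>l\<in>S. s l * (\<Prod>j\<in>insert a S - {l}. y j)) = y a * (\<Sum>l\<in>S. s l * (\<Prod>j\<in>S - {l}. y j))"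
    by (simp add: sum_distrib_left algebra_simps)
  moreover have "insert a S - {a} = S" using insert.hyps by auto
  ultimately show ?case
    using insert by (simp add: coeff_0_prod_linear)
qed simp

text \<open>Double counting of sets with a marked element, which is then removed from the set; it
  converts a sum over coefficients into one over partial derivatives.\<close>

lemma sum_level_by_element:
  fixes g :: "'a set \<Rightarrow> 'a \<Rightarrow> real"
  assumes "finite M"
  shows "(\<Sum>S | S \<subseteq> M \<and> P S. \<Sum>l\<in>S. g S l) =
    (\<Sum>l\<in>M. \<Sum>S | S \<subseteq> M \<and> l \<notin> S \<and> P (insert l S). g (insert l S) l)"
proof -
  have "(\<Sum>S | S \<subseteq> M \<and> P S. \<Sum>l\<in>S. g S l) = (\<Sum>S | S \<subseteq> M \<and> P S. \<Sum>l | l \<in> M \<and> l \<in> S. g S l)"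
    by (intro sum.cong) auto
  also have "\<dots> = (\<Sum>l\<in>M. \<Sum>S | S \<in> {S. S \<subseteq> M \<and> P S} \<and> l \<in> S. g S l)"
    using assms by (intro sum.swap_restrict) auto
  also have "\<dots> = (\<Sum>l\<in>M. \<Sum>S | S \<subseteq> M \<and> l \<notin> S \<and> P (insert l S). g (insert l S) l)"
  proof (rule sum.cong[OF refl])
    fix l assume "l \<in> M"
    then show "(\<Sum>S | S \<in> {S. S \<subseteq> M \<and> P S} \<and> l \<in> S. g S l) =
        (\<Sum>S | S \<subseteq> M \<and> l \<notin> S \<and> P (insert l S). g (insert l S) l)"
      by - (rule sum.reindex_bij_witness[of _ "insert l" "\<lambda>S. S - {l}"],
        auto simp: insert_absorb)
  qed
  finally show ?thesis .
qed

text \<open>The gain of a factor \<open>sqrt n\<close> over \<open>first_moment_wpoly_level\<close>: evaluate the multilinear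
  extension at \<open>x\<^sub>l = \<delta>\<^sub>l / 2 + b s\<^sub>l\<close> with random signs \<open>\<delta>\<close>. The signs \<open>s\<^sub>l\<close> are chosen so that the
  linear coefficient in \<open>b\<close> is a sum of absolute values of polynomials in \<open>\<delta>\<close> of level one less.\<close>

lemma level_sum_le_sup:
  "\<exists>C>0. \<forall>(M::'a set) n c B i. finite M \<longrightarrow> card M \<le> n \<longrightarrow> (\<forall>S\<subseteq>M. k < card S \<longrightarrow> c S = 0) \<longrightarrow>
    (\<forall>e\<subseteq>M. \<bar>wpoly M c e\<bar> \<le> B) \<longrightarrow> i \<le> k \<longrightarrow>
    (\<Sum>S | S \<subseteq> M \<and> card S = Suc i. \<bar>c S\<bar>) \<le> C * sqrt (real n) ^ i * B"
proof -
  obtain C where C: "C > 0"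
    "\<And>(p::real poly) B. degree p \<le> k \<Longrightarrow> (\<forall>b\<in>{0..1/2}. \<bar>poly p b\<bar> \<le> B) \<Longrightarrow> \<bar>coeff p 1\<bar> \<le> C * B"
    using linear_coeff_bound[of k] by blast
  show ?thesis
  proof (intro exI[of _ "2 ^ k * 3 ^ Suc k * C"] conjI allI impI)
    show "0 < 2 ^ k * 3 ^ Suc k * C" using C(1) by simp
  next
    fix M :: "'a set" and n c B i
    assume M: "finite M" "card M \<le> n" and c: "\<forall>S\<subseteq>M. k < card S \<longrightarrow> c S = 0"
      and B: "\<forall>e\<subseteq>M. \<bar>wpoly M c e\<bar> \<le> B" and i: "i \<le> k"
    \<comment> \<open>\<open>wpoly M (d l)\<close> is the partial derivative of the multilinear
      extension in coordinate \<open>l\<close>, at a point with all entries \<open>1 / 2\<close> up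
      to sign; this explains the powers of 2.\<close>
    define d where "d = (\<lambda>l S. if l \<in> S then 0 else c (insert l S) / 2 ^ card S)"
    have B0: "B \<ge> 0" using B by force
    have fin: "finite S" if "S \<subseteq> M" for S using that M finite_subset by auto
    have lin: "(\<Sum>l\<in>M. \<bar>wpoly M (d l) e\<bar>) \<le> C * B" if e: "e \<in> Pow M" for e
    proof -
      define y where "y = (\<lambda>l. (if l \<in> e then - 1 else 1 :: real) / 2)"
      define s where "s = (\<lambda>l. sgn (wpoly M (d l) e))"
      define p where "p = (\<Sum>S\<in>Pow M. smult (c S) (\<Prod>l\<in>S. [:y l, s l:]))"
      have "degree p \<le> k"
        unfolding p_def
      proof (rule degree_sum_le)
        fix S assume S: "S \<in> Pow M"
        show "degree (smult (c S) (\<Prod>l\<in>S. [:y l, s l:])) \<le> k"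
        proof (cases "k < card S")
          case False
          have "degree (\<Prod>l\<in>S. [:y l, s l:]) \<le> (\<Sum>l\<in>S. degree [:y l, s l:])"
            using degree_prod_sum_le[of S "\<lambda>l. [:y l, s l:]"] S fin by (auto simp: o_def)
          also have "\<dots> \<le> (\<Sum>l\<in>S. 1)" by (intro sum_mono) auto
          finally show ?thesis using False degree_smult_le[of "c S"] by (auto intro: order_trans)
        qed (use c S in auto)
      qed (use M in auto)
      moreover have "\<bar>poly p b\<bar> \<le> B" if b: "b \<in> {0..1/2}" for b
      proof -
        have "\<bar>s l\<bar> \<le> 1" for l by (simp add: s_def abs_sgn_eq)
        then have "\<bar>b * s l\<bar> \<le> 1 / 2" for l
          using b mult_mono[of "\<bar>b\<bar>" "1/2" "\<bar>s l\<bar>" 1] by (simp add: abs_mult)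
        moreover have "\<bar>y l\<bar> = 1 / 2" for l by (simp add: y_def)
        ultimately have "\<bar>y l + b * s l\<bar> \<le> 1" for l
          using abs_triangle_ineq[of "y l" "b * s l"] by (smt (verit) field_sum_of_halves)
        then have "\<bar>\<Sum>S\<in>Pow M. c S * (\<Prod>l\<in>S. y l + b * s l)\<bar> \<le> B"
          using M B by (intro multilinear_bound) auto
        then show ?thesis by (simp add: p_def poly_sum poly_prod)
      qed
      ultimately have "\<bar>coeff p 1\<bar> \<le> C * B" using C(2) by blast
      moreover have "coeff p 1 = (\<Sum>l\<in>M. \<bar>wpoly M (d l) e\<bar>)"
      proof -
        have "coeff p 1 = (\<Sum>S | S \<subseteq> M \<and> True. \<Sum>l\<in>S. c S * (s l * (\<Prod>j\<in>S - {l}. y j)))"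
          unfolding p_def coeff_sum coeff_smult using fin
          by (intro sum.cong) (auto simp: coeff_1_prod_linear[unfolded One_nat_def] sum_distrib_left)
        also have "\<dots> = (\<Sum>l\<in>M. \<Sum>S | S \<subseteq> M \<and> l \<notin> S \<and> True.
            c (insert l S) * (s l * (\<Prod>j\<in>insert l S - {l}. y j)))"
          by (rule sum_level_by_element) (rule M)
        also have "\<dots> = (\<Sum>l\<in>M. s l * wpoly M (d l) e)"
        proof (rule sum.cong[OF refl])
          fix l
          have y: "(\<Prod>j\<in>S. y j) = walsh S e / 2 ^ card S" for S
            by (simp add: y_def walsh_def prod_dividef)
          have "s l * wpoly M (d l) e = (\<Sum>S | S \<subseteq> M. s l * (d l S * walsh S e))"
            by (simp add: wpoly_def sum_distrib_left Pow_def)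
          also have "\<dots> = (\<Sum>S | S \<subseteq> M \<and> l \<notin> S \<and> True. s l * (d l S * walsh S e))"
            using M by (intro sum.mono_neutral_right) (auto simp: d_def)
          also have "\<dots> = (\<Sum>S | S \<subseteq> M \<and> l \<notin> S \<and> True.
              c (insert l S) * (s l * (\<Prod>j\<in>insert l S - {l}. y j)))"
            by (intro sum.cong refl) (auto simp: d_def y)
          finally show "(\<Sum>S | S \<subseteq> M \<and> l \<notin> S \<and> True.
              c (insert l S) * (s l * (\<Prod>j\<in>insert l S - {l}. y j))) = s l * wpoly M (d l) e" ..
        qed
        also have "\<dots> = (\<Sum>l\<in>M. \<bar>wpoly M (d l) e\<bar>)"
          by (simp add: s_def linordered_idom_class.abs_sgn mult.commute)
        finally show ?thesis .
      qed
      ultimately show ?thesis by linarith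
    qed
    \<comment> \<open>Counting each set once for every element only increases the sum and brings in
      the partial derivatives.\<close>
    have "(\<Sum>S | S \<subseteq> M \<and> card S = Suc i. \<bar>c S\<bar>) \<le> (\<Sum>S | S \<subseteq> M \<and> card S = Suc i. \<Sum>l\<in>S. \<bar>c S\<bar>)"
      by (intro sum_mono) (simp add: mult_le_cancel_right1)
    also have "\<dots> = (\<Sum>l\<in>M. \<Sum>S | S \<subseteq> M \<and> l \<notin> S \<and> card (insert l S) = Suc i. \<bar>c (insert l S)\<bar>)"
      by (rule sum_level_by_element) (rule M)
    also have "\<dots> = (\<Sum>l\<in>M. \<Sum>S | S \<subseteq> M \<and> card S = i. 2 ^ i * \<bar>d l S\<bar>)"
    proof (rule sum.cong[OF refl])
      fix l
      have "(\<Sum>S | S \<subseteq> M \<and> card S = i. 2 ^ i * \<bar>d l S\<bar>)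
          = (\<Sum>S | S \<subseteq> M \<and> l \<notin> S \<and> card (insert l S) = Suc i. 2 ^ i * \<bar>d l S\<bar>)"
        using M fin by (intro sum.mono_neutral_right) (auto simp: d_def)
      also have "\<dots> = (\<Sum>S | S \<subseteq> M \<and> l \<notin> S \<and> card (insert l S) = Suc i. \<bar>c (insert l S)\<bar>)"
        using fin by (intro sum.cong refl) (auto simp: d_def abs_divide)
      finally show "(\<Sum>S | S \<subseteq> M \<and> l \<notin> S \<and> card (insert l S) = Suc i. \<bar>c (insert l S)\<bar>)
          = (\<Sum>S | S \<subseteq> M \<and> card S = i. 2 ^ i * \<bar>d l S\<bar>)" ..
    qed
    also have "\<dots> = 2 ^ i * (\<Sum>l\<in>M. \<Sum>S | S \<subseteq> M \<and> card S = i. \<bar>d l S\<bar>)"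
      by (simp add: sum_distrib_left)
    finally have 1: "(\<Sum>S | S \<subseteq> M \<and> card S = Suc i. \<bar>c S\<bar>)
        \<le> 2 ^ i * (\<Sum>l\<in>M. \<Sum>S | S \<subseteq> M \<and> card S = i. \<bar>d l S\<bar>)" .
    have "2 ^ card M * (\<Sum>S | S \<subseteq> M \<and> card S = Suc i. \<bar>c S\<bar>)
        \<le> 2 ^ i * (\<Sum>l\<in>M. 2 ^ card M * (\<Sum>S | S \<subseteq> M \<and> card S = i. \<bar>d l S\<bar>))"
      using mult_left_mono[OF 1, of "2 ^ card M"]
      by (simp add: sum_distrib_left[symmetric] mult.left_commute)
    \<comment> \<open>The first-moment bound is applied to the derivatives at level
      \<open>i\<close>, one below \<open>Suc i\<close>; this is where the factor
      \<open>sqrt n\<close> is gained.\<close>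
    also have "\<dots> \<le> 2 ^ i * (\<Sum>l\<in>M. sqrt (real n) ^ i * 3 ^ Suc k * (\<Sum>e\<in>Pow M. \<bar>wpoly M (d l) e\<bar>))"
    proof (intro mult_left_mono sum_mono first_moment_wpoly_level M)
      fix l S assume "l \<in> M" "S \<subseteq> M" "k < card S"
      then show "d l S = 0"
        using c[rule_format, of "insert l S"] fin[of S] by (auto simp: d_def card_insert_if)
    qed auto
    \<comment> \<open>With the sum over \<open>l\<close> inside, \<open>lin\<close> applies for each
      \<open>e\<close>, so the number of coordinates costs nothing.\<close>
    also have "\<dots> = 2 ^ i * (sqrt (real n) ^ i * 3 ^ Suc k * (\<Sum>e\<in>Pow M. \<Sum>l\<in>M. \<bar>wpoly M (d l) e\<bar>))"
      by (subst sum.swap) (simp add: sum_distrib_left)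
    also have "\<dots> \<le> 2 ^ k * (sqrt (real n) ^ i * 3 ^ Suc k * (\<Sum>e\<in>Pow M. C * B))"
      using i B0 C(1) lin
      by (intro mult_mono mult_left_mono power_increasing sum_mono)
        (auto intro!: mult_nonneg_nonneg sum_nonneg)
    also have "\<dots> = 2 ^ card M * (2 ^ k * 3 ^ Suc k * C * sqrt (real n) ^ i * B)"
      using M by (simp add: card_Pow)
    finally show "(\<Sum>S | S \<subseteq> M \<and> card S = Suc i. \<bar>c S\<bar>) \<le> 2 ^ k * 3 ^ Suc k * C * sqrt (real n) ^ i * B"
      by simp
  qed
qed

section \<open>Pattern sums and the norm\<close>

lemma sum_permutes_right:
  assumes "p permutes V"
  shows "(\<Sum>\<sigma> | \<sigma> permutes V. g (\<sigma> \<circ> p)) = (\<Sum>\<sigma> | \<sigma> permutes V. g \<sigma>)"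
  using sum_permutations_compose_right[OF assms, of g] by simp

lemma finite_ksubsets [simp]: "finite V \<Longrightarrow> finite (ksubsets V k)"
  by (rule finite_subset[of _ "Pow V"]) (auto simp: ksubsets_def)

lemma card_ksubsets: "finite V \<Longrightarrow> card (ksubsets V k) = card V choose k"
  by (simp add: ksubsets_def n_subsets)

lemma image_in_ksubsets:
  assumes "p permutes V" "f \<in> ksubsets V k"
  shows "p ` f \<in> ksubsets V k"
proof -
  have "inj_on p f" using permutes_inj[OF assms(1)] by (rule inj_on_subset) simp
  then show ?thesis
    using assms by (auto simp: ksubsets_def card_image permutes_in_image)
qed

lemma sum_ksubsets_image:
  assumes "p permutes V"
  shows "(\<Sum>f\<in>ksubsets V k. g (p ` f)) = (\<Sum>f\<in>ksubsets V k. g f)"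
  by (rule sum.reindex_bij_witness[of _ "(`) (inv p)" "(`) p"])
    (use assms in \<open>auto simp: image_image permutes_inverses image_in_ksubsets permutes_inv\<close>)

lemma ex_permutes_image_eq:
  assumes "finite V" "A \<subseteq> V" "B \<subseteq> V" "card A = card B"
  obtains p where "p permutes V" "p ` A = B"
proof -
  have fin: "finite A" "finite B" using assms finite_subset by auto
  obtain g where g: "bij_betw g A B"
    using fin assms(4) finite_same_card_bij by blast
  have "card (V - A) = card (V - B)" using assms fin by (simp add: card_Diff_subset)
  then obtain h where h: "bij_betw h (V - A) (V - B)"
    using assms(1) finite_same_card_bij by (metis finite_Diff)
  define p where "p = (\<lambda>x. if x \<in> A then g x else if x \<in> V then h x else x)"
  have "bij_betw p A B" using g by (rule bij_betw_cong[THEN iffD1, rotated]) (auto simp: p_def)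
  moreover have "bij_betw p (V - A) (V - B)"
    using h by (rule bij_betw_cong[THEN iffD1, rotated]) (auto simp: p_def)
  ultimately have "bij_betw p (A \<union> (V - A)) (B \<union> (V - B))"
    by (rule bij_betw_combine) auto
  then have "bij_betw p V V" using assms by (simp add: Un_absorb1)
  then have "p permutes V"
    by (rule bij_imp_permutes) (use assms in \<open>auto simp: p_def\<close>)
  moreover have "p ` A = B" using \<open>bij_betw p A B\<close> by (simp add: bij_betw_def)
  ultimately show ?thesis using that by blast
qed

text \<open>The positions \<open>l\<close> and \<open>m + l\<close>, for \<open>l \<in> {1..m}\<close>, form a pair. For a permutation \<open>\<sigma>\<close> the pattern
  sum is the alternating sum of \<open>w\<close> over the edges that contain \<open>\<sigma> ` J\<close> and exactly one vertex of each
  pair indexed by \<open>R\<close>.\<close>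

definition pair_sign :: "nat \<Rightarrow> nat set \<Rightarrow> nat set \<Rightarrow> real" where
  "pair_sign m S f = (\<Prod>l\<in>S. of_bool (l \<in> f) - of_bool (m + l \<in> f))"

definition pattern_sum :: "nat \<Rightarrow> nat \<Rightarrow> nat \<Rightarrow> nat set \<Rightarrow> nat set \<Rightarrow> (nat set \<Rightarrow> real) \<Rightarrow> (nat \<Rightarrow> nat) \<Rightarrow> real" where
  "pattern_sum n k m R J w \<sigma> =
    (\<Sum>f\<in>ksubsets {1..n} k. w (\<sigma> ` f) * (pair_sign m R f * of_bool (J \<subseteq> f)))"

text \<open>For \<open>J = {}\<close> and \<open>card R = i\<close> this is \<open>fact n\<close>
  times the quantity \<open>A\<^sub>i(w)\<close>; leaving it unnormalised avoids divisions.\<close>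

definition pattern_norm :: "nat \<Rightarrow> nat \<Rightarrow> nat \<Rightarrow> nat set \<Rightarrow> nat set \<Rightarrow> (nat set \<Rightarrow> real) \<Rightarrow> real" where
  "pattern_norm n k m R J w = (\<Sum>\<sigma> | \<sigma> permutes {1..n}. \<bar>pattern_sum n k m R J w \<sigma>\<bar>)"

lemma pattern_norm_nonneg [simp]: "0 \<le> pattern_norm n k m R J w"
  by (simp add: pattern_norm_def sum_nonneg)

lemma pair_sign_nonzero_iff:
  assumes "finite S"
  shows "pair_sign m S f \<noteq> 0 \<longleftrightarrow> (\<forall>l\<in>S. l \<in> f \<longleftrightarrow> m + l \<notin> f)"
  unfolding pair_sign_def using assms by (auto simp: prod_zero_iff of_bool_def split: if_splits)

lemma pair_sign_image_fixed:
  assumes "inj p" "\<And>l. l \<in> S \<Longrightarrow> p l = l \<and> p (m + l) = m + l"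
  shows "pair_sign m S (p ` f) = pair_sign m S f"
  unfolding pair_sign_def
proof (rule prod.cong[OF refl])
  fix l assume "l \<in> S"
  then have "l \<in> p ` f \<longleftrightarrow> l \<in> f" "m + l \<in> p ` f \<longleftrightarrow> m + l \<in> f"
    using inj_image_mem_iff[OF assms(1), of l f] inj_image_mem_iff[OF assms(1), of "m + l" f] assms(2)[of l]
    by auto
  then show "of_bool (l \<in> p ` f) - of_bool (m + l \<in> p ` f)
      = (of_bool (l \<in> f) - of_bool (m + l \<in> f) :: real)" by simp
qed

text \<open>Sending \<open>l\<close> to the vertex of its pair that lies in \<open>f\<close> is a
  bijection.\<close>

lemma card_transversal:
  fixes S :: "nat set"
  assumes "S \<subseteq> {1..m}" "\<And>l. l \<in> S \<Longrightarrow> l \<in> f \<longleftrightarrow> m + l \<notin> f"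
  shows "card (f \<inter> (S \<union> (+) m ` S)) = card S"
proof -
  define c where "c = (\<lambda>l. if l \<in> f then l else m + l)"
  have bound: "1 \<le> x \<and> x \<le> m" if "x \<in> S" for x using assms(1) that by auto
  have "inj_on c S"
  proof (rule inj_onI)
    fix x y assume "x \<in> S" "y \<in> S" "c x = c y"
    then show "x = y" using bound[of x] bound[of y] by (auto simp: c_def split: if_splits)
  qed
  moreover have "c ` S = f \<inter> (S \<union> (+) m ` S)"
    using assms(2) by (auto simp: c_def image_iff split: if_splits)
  ultimately show ?thesis using card_image by metis
qed

text \<open>Replacing the vertex at position \<open>l\<close> by any vertex \<open>z\<close> that is not in use, the average over
  \<open>z\<close> is a multiple of the pattern sum without \<open>l\<close>, since the number of vertices of an edge outside
  the pattern is fixed, while each difference has the distribution of the pattern with the pair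
  \<open>(l, m + l)\<close>.\<close>

lemma pattern_norm_step:
  assumes J: "finite J" "J \<subseteq> {1..m}" and R: "finite R" "R \<subseteq> {1..m}" and l: "l \<in> {1..m}" "l \<notin> J" "l \<notin> R"
    and RJ: "R \<inter> J = {}" and m: "2 * m \<le> n" and k: "card R + card J < k" "2 * k \<le> n"
  shows "pattern_norm n k m R (insert l J) w \<le>
    pattern_norm n k m (insert l R) J w + real k ^ 2 / real n * pattern_norm n k m R J w"
proof -
  define V where "V = {1..n}"
  define Q where "Q = R \<union> (+) m ` R"
  define B where "B = V - (Q \<union> J)"
  define G where "G = (\<lambda>f z. pair_sign m R f * of_bool (J \<subseteq> f) * of_bool (z \<in> f) :: real)"
  \<comment> \<open>\<open>a z\<close> is the pattern sum in which position \<open>z\<close> is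
    required in addition to \<open>J\<close>; \<open>B\<close> consists of the positions not in
    use.\<close>
  define a where "a = (\<lambda>z \<sigma>. \<Sum>f\<in>ksubsets V k. w (\<sigma> ` f) * G f z)"
  define b where "b = pattern_sum n k m R J w"
  define t where "t = k - card R - card J"
  have Q: "Q \<subseteq> V" "card Q = 2 * card R" "finite Q" "J \<inter> Q = {}"
  proof -
    show "Q \<subseteq> V" using R m by (auto simp: Q_def V_def)
    have out: "m + x \<notin> {1..m}" if "x \<in> {1..m}" for x using that by auto
    then have "R \<inter> (+) m ` R = {}" using R by blast
    then show "card Q = 2 * card R"
      unfolding Q_def using R by (simp add: card_Un_disjoint card_image)
    show "finite Q" using R by (simp add: Q_def)
    show "J \<inter> Q = {}" using RJ J R out unfolding Q_def by blast
  qed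
  have JV: "J \<subseteq> V" using J m by (auto simp: V_def)
  have lB: "l \<in> B" "m + l \<in> B" "m + l \<noteq> l"
    using l J R m by (auto simp: B_def Q_def V_def)
  have "card (Q \<union> J) = 2 * card R + card J"
    using Q J by (subst card_Un_disjoint) auto
  then have cB: "card B = n - (2 * card R + card J)"
    unfolding B_def using Q J JV by (subst card_Diff_subset) (auto simp: V_def)
  have finB: "finite B" by (simp add: B_def V_def)
  have move: "a z (\<sigma> \<circ> p) = a (p z) \<sigma>" if p: "p permutes V" "\<And>x. x \<in> Q \<union> J \<Longrightarrow> p x = x" for p z \<sigma>
  proof -
    have inj: "inj p" using p permutes_inj by blast
    have "G f z = G (p ` f) (p z)" for f
    proof -
      have "pair_sign m R (p ` f) = pair_sign m R f"
        by (rule pair_sign_image_fixed[OF inj]) (use p in \<open>auto simp: Q_def\<close>)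
      moreover have "J \<subseteq> p ` f \<longleftrightarrow> J \<subseteq> f"
      proof -
        have "p ` J = J" using p(2) by auto
        then show ?thesis using inj_image_subset_iff[OF inj, of J f] by simp
      qed
      ultimately show ?thesis
        by (simp add: G_def inj_image_mem_iff[OF inj])
    qed
    then have "a z (\<sigma> \<circ> p) = (\<Sum>f\<in>ksubsets V k. (\<lambda>f. w (\<sigma> ` f) * G f (p z)) (p ` f))"
      by (simp add: a_def image_comp)
    also have "\<dots> = a (p z) \<sigma>"
      unfolding a_def by (rule sum_ksubsets_image[OF p(1)])
    finally show ?thesis .
  qed
  have al: "a l \<sigma> = pattern_sum n k m R (insert l J) w \<sigma>" for \<sigma>
    unfolding a_def pattern_sum_def V_def G_def by (intro sum.cong) (auto simp: of_bool_def)
  have diff: "a l \<sigma> - a (m + l) \<sigma> = pattern_sum n k m (insert l R) J w \<sigma>" for \<sigma>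
    unfolding a_def pattern_sum_def V_def G_def sum_subtractf[symmetric]
    using R l by (intro sum.cong) (auto simp: pair_sign_def algebra_simps)
  have orbit: "(\<Sum>\<sigma> | \<sigma> permutes V. \<bar>a l \<sigma> - a z \<sigma>\<bar>) = pattern_norm n k m (insert l R) J w"
    if z: "z \<in> B - {l}" for z
  proof -
    \<comment> \<open>The transposition fixes \<open>l\<close> and all positions in use and moves
      \<open>m + l\<close> to \<open>z\<close>, so right translation by it carries the pair with
      \<open>m + l\<close> to the pair with \<open>z\<close>.\<close>
    define p where "p = Transposition.transpose z (m + l)"
    have p: "p permutes V" "\<And>x. x \<in> Q \<union> J \<Longrightarrow> p x = x" "p l = l" "p (m + l) = z"
      using z lB by (auto simp: p_def B_def permutes_swap_id Transposition.transpose_def)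
    have "(\<Sum>\<sigma> | \<sigma> permutes V. \<bar>a l \<sigma> - a (m + l) \<sigma>\<bar>)
        = (\<Sum>\<sigma> | \<sigma> permutes V. \<bar>a l (\<sigma> \<circ> p) - a (m + l) (\<sigma> \<circ> p)\<bar>)"
      using sum_permutes_right[OF p(1), of "\<lambda>\<sigma>. \<bar>a l \<sigma> - a (m + l) \<sigma>\<bar>"] by (rule sym)
    also have "\<dots> = (\<Sum>\<sigma> | \<sigma> permutes V. \<bar>a l \<sigma> - a z \<sigma>\<bar>)"
      by (simp only: move[OF p(1,2)] p(3,4))
    finally show ?thesis
      by (simp add: diff pattern_norm_def V_def)
  qed
  \<comment> \<open>An edge with nonzero coefficient contains \<open>J\<close> and one vertex of
    each pair of \<open>R\<close>, so exactly \<open>t\<close> of its vertices lie in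
    \<open>B\<close>.\<close>
  have total: "(\<Sum>z\<in>B. a z \<sigma>) = real t * b \<sigma>" for \<sigma>
  proof -
    have "(\<Sum>z\<in>B. a z \<sigma>) = (\<Sum>f\<in>ksubsets V k. \<Sum>z\<in>B. w (\<sigma> ` f) * G f z)"
      unfolding a_def by (rule sum.swap)
    also have "\<dots> = (\<Sum>f\<in>ksubsets V k. real t * (w (\<sigma> ` f) * (pair_sign m R f * of_bool (J \<subseteq> f))))"
    proof (rule sum.cong[OF refl])
      fix f assume f: "f \<in> ksubsets V k"
      then have f': "finite f" "f \<subseteq> V" "card f = k"
        by (auto simp: ksubsets_def V_def finite_subset)
      have "card (f \<inter> B) = t" if *: "pair_sign m R f \<noteq> 0" "J \<subseteq> f"
      proof -
        have "card (f \<inter> Q) = card R"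
          unfolding Q_def using * R pair_sign_nonzero_iff by (intro card_transversal) auto
        then have "card ((f \<inter> Q) \<union> J) = card R + card J"
          using Q J f' by (subst card_Un_disjoint) auto
        moreover have "f \<inter> B = f - ((f \<inter> Q) \<union> J)"
          using f' by (auto simp: B_def)
        ultimately show ?thesis
          using *(2) f' J by (simp add: card_Diff_subset t_def)
      qed
      moreover have "(\<Sum>z\<in>B. of_bool (z \<in> f)) = real (card (f \<inter> B))"
        using finB by (simp add: of_bool_def sum.If_cases Int_def conj_commute)
      ultimately show "(\<Sum>z\<in>B. w (\<sigma> ` f) * G f z) = real t * (w (\<sigma> ` f) * (pair_sign m R f * of_bool (J \<subseteq> f)))"
        unfolding G_def sum_distrib_left[symmetric] mult.assoc[symmetric]
        by (cases "pair_sign m R f = 0"; cases "J \<subseteq> f") auto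
    qed
    also have "\<dots> = real t * b \<sigma>"
      by (simp add: b_def pattern_sum_def sum_distrib_left V_def)
    finally show ?thesis .
  qed
  have pt: "real (card B) * \<bar>a l \<sigma>\<bar> \<le> (\<Sum>z\<in>B - {l}. \<bar>a l \<sigma> - a z \<sigma>\<bar>) + real t * \<bar>b \<sigma>\<bar>" for \<sigma>
  proof -
    have "real (card B) * a l \<sigma> = (\<Sum>z\<in>B. a l \<sigma> - a z \<sigma>) + (\<Sum>z\<in>B. a z \<sigma>)"
      by (simp add: sum_subtractf)
    also have "(\<Sum>z\<in>B. a l \<sigma> - a z \<sigma>) = (\<Sum>z\<in>B - {l}. a l \<sigma> - a z \<sigma>)"
      using lB finB by (simp add: sum.remove)
    finally have "\<bar>real (card B) * a l \<sigma>\<bar> \<le> \<bar>\<Sum>z\<in>B - {l}. a l \<sigma> - a z \<sigma>\<bar> + \<bar>real t * b \<sigma>\<bar>"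
      unfolding total by linarith
    also have "\<dots> \<le> (\<Sum>z\<in>B - {l}. \<bar>a l \<sigma> - a z \<sigma>\<bar>) + real t * \<bar>b \<sigma>\<bar>"
      by (simp add: abs_mult)
    finally show ?thesis by (simp add: abs_mult)
  qed
  let ?A = "pattern_norm n k m R (insert l J) w" and ?B = "pattern_norm n k m (insert l R) J w"
    and ?C = "pattern_norm n k m R J w"
  have "real (card B) * ?A = (\<Sum>\<sigma> | \<sigma> permutes V. real (card B) * \<bar>a l \<sigma>\<bar>)"
    by (simp add: pattern_norm_def al V_def sum_distrib_left)
  also have "\<dots> \<le> (\<Sum>\<sigma> | \<sigma> permutes V. (\<Sum>z\<in>B - {l}. \<bar>a l \<sigma> - a z \<sigma>\<bar>) + real t * \<bar>b \<sigma>\<bar>)"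
    by (intro sum_mono pt)
  also have "\<dots> = (\<Sum>z\<in>B - {l}. \<Sum>\<sigma> | \<sigma> permutes V. \<bar>a l \<sigma> - a z \<sigma>\<bar>) + real t * ?C"
    by (simp add: sum.distrib sum.swap[of _ "B - {l}"] pattern_norm_def b_def V_def sum_distrib_left)
  also have "\<dots> = real (card (B - {l})) * ?B + real t * ?C"
    by (simp add: orbit)
  also have "\<dots> \<le> real (card B) * ?B + real t * ?C"
    using finB by (intro add_right_mono mult_right_mono) (auto intro: card_mono)
  finally have main: "real (card B) * ?A \<le> real (card B) * ?B + real t * ?C" .
  \<comment> \<open>At most \<open>2 * (k - 1)\<close> positions are in use, whence
    \<open>n \<le> card B * k\<close>; with \<open>t \<le> k\<close> this produces the factor
    \<open>k ^ 2 / n\<close>.\<close>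
  have "n - 2 * k + 2 \<le> card B" using k by (simp add: cB)
  then have "(n - 2 * k + 2) * k \<le> card B * k" by (rule mult_le_mono1)
  moreover have "n \<le> (n - 2 * k + 2) * k"
  proof -
    have "(n - 2 * k) * 1 \<le> (n - 2 * k) * k" using k by (intro mult_le_mono2) auto
    then show ?thesis using k(2) unfolding add_mult_distrib by linarith
  qed
  ultimately have "n \<le> card B * k" by linarith
  moreover have "t \<le> k" by (simp add: t_def)
  ultimately have "t * n \<le> k * (card B * k)" by (rule mult_le_mono[rotated])
  then have "real t * real n \<le> real k ^ 2 * real (card B)"
    by (simp add: power2_eq_square mult_ac flip: of_nat_mult)
  moreover have pos: "real (card B) > 0" "real n > 0"
    using lB finB k by (auto simp: card_gt_0_iff)
  ultimately have "real t / real (card B) \<le> real k ^ 2 / real n"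
    by (simp add: field_simps)
  then have "real t / real (card B) * ?C \<le> real k ^ 2 / real n * ?C"
    by (rule mult_right_mono) simp
  moreover have "?A \<le> ?B + real t / real (card B) * ?C"
    using main pos(1) by (simp add: field_simps)
  ultimately show ?thesis by linarith
qed

text \<open>Iterates the previous step: each vertex of \<open>J\<close> either becomes a crossed
  pair, collected in \<open>T\<close>, or is dropped at the price of a factor
  \<open>k ^ 2 / n\<close>.\<close>

lemma pattern_norm_expand:
  assumes "finite J" "J \<subseteq> {1..m}" "finite R" "R \<subseteq> {1..m}" "R \<inter> J = {}" "2 * m \<le> n"
    "card R + card J \<le> k" "2 * k \<le> n"
  shows "pattern_norm n k m R J w \<le>
    (\<Sum>T\<in>Pow J. (real k ^ 2 / real n) ^ (card J - card T) * pattern_norm n k m (R \<union> T) {} w)"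
  using assms
proof (induction J arbitrary: R)
  case empty
  then show ?case by simp
next
  case (insert l J)
  let ?q = "real k ^ 2 / real n"
  have card: "card (insert l R) = Suc (card R)" "card (insert l J) = Suc (card J)"
    using insert by auto
  have "pattern_norm n k m R (insert l J) w \<le>
      pattern_norm n k m (insert l R) J w + ?q * pattern_norm n k m R J w"
    by (rule pattern_norm_step) (use insert card in auto)
  also have "\<dots> \<le> (\<Sum>T\<in>Pow J. ?q ^ (card J - card T) * pattern_norm n k m (insert l R \<union> T) {} w)
      + ?q * (\<Sum>T\<in>Pow J. ?q ^ (card J - card T) * pattern_norm n k m (R \<union> T) {} w)"
    by (intro add_mono mult_left_mono insert.IH) (use insert card in auto)
  also have "\<dots> = (\<Sum>T\<in>Pow (insert l J). ?q ^ (card (insert l J) - card T) * pattern_norm n k m (R \<union> T) {} w)"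
  proof -
    have "?q ^ (Suc (card J) - card T) = ?q * ?q ^ (card J - card T)" if "T \<in> Pow J" for T
      using that insert.hyps card_mono[of J T] by (simp add: Suc_diff_le)
    moreover have "card (insert l T) = Suc (card T)" if "T \<in> Pow J" for T
      using that insert.hyps finite_subset[of T J] by (subst card_insert_disjoint) auto
    ultimately show ?thesis
      using insert.hyps card(2)
      by (simp add: sum_Pow_insert sum.distrib sum_distrib_left mult.assoc)
  qed
  finally show ?case .
qed

text \<open>A permutation of the indices \<open>{1..m}\<close> taking \<open>S\<close> to
  \<open>T\<close> is applied to both halves at once, so that pairs go to pairs, and the sum over
  all permutations is invariant under it.\<close>

lemma pattern_norm_cong_card:
  assumes "S \<subseteq> {1..m}" "T \<subseteq> {1..m}" "card S = card T" "2 * m \<le> n"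
  shows "pattern_norm n k m S {} w = pattern_norm n k m T {} w"
proof -
  obtain b where b: "b permutes {1..m}" "b ` S = T"
    using ex_permutes_image_eq[of "{1..m}" S T] assms by auto
  define p where "p = (\<lambda>x. if x \<in> {m + 1..2 * m} then m + b (x - m) else b x)"
  have bin: "b x \<in> {1..m} \<longleftrightarrow> x \<in> {1..m}" for x using b(1) permutes_in_image by metis
  have bout: "b x = x" if "x \<notin> {1..m}" for x using b(1) that by (auto simp: permutes_def)
  have injb: "inj b" using b permutes_inj by blast
  have "p permutes {1..2 * m}"
  proof (rule bij_imp_permutes)
    have "inj_on p {1..2 * m}"
    proof (rule inj_onI)
      fix x y assume *: "x \<in> {1..2 * m}" "y \<in> {1..2 * m}" "p x = p y"
      show "x = y"
        using * bin[of x] bin[of y] bin[of "x - m"] bin[of "y - m"] injD[OF injb, of x y] injD[OF injb, of "x - m" "y - m"]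
        by (auto simp: p_def split: if_splits)
    qed
    moreover have "p ` {1..2 * m} \<subseteq> {1..2 * m}"
    proof (rule image_subsetI)
      fix x assume "x \<in> {1..2 * m}"
      then show "p x \<in> {1..2 * m}"
        using bin[of x] bin[of "x - m"] by (auto simp: p_def)
    qed
    ultimately show "bij_betw p {1..2 * m} {1..2 * m}"
      by (simp add: bij_betw_def endo_inj_surj)
  qed (auto simp: p_def intro!: bout)
  then have p: "p permutes {1..n}" by (rule permutes_subset) (use assms in auto)
  then have inj: "inj p" using permutes_inj by blast
  have sign: "pair_sign m T (p ` f) = pair_sign m S f" for f
  proof -
    have "pair_sign m T (p ` f) = (\<Prod>l\<in>S. of_bool (b l \<in> p ` f) - of_bool (m + b l \<in> p ` f))"
      unfolding pair_sign_def b(2)[symmetric] using injb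
      by (subst prod.reindex) (auto simp: inj_on_def inj_def)
    also have "\<dots> = pair_sign m S f"
      unfolding pair_sign_def
    proof (rule prod.cong[OF refl])
      fix l assume "l \<in> S"
      then have "p l = b l" "p (m + l) = m + b l"
        using assms by (auto simp: p_def)
      then have "b l \<in> p ` f \<longleftrightarrow> l \<in> f" "m + b l \<in> p ` f \<longleftrightarrow> m + l \<in> f"
        using inj_image_mem_iff[OF inj, of l f] inj_image_mem_iff[OF inj, of "m + l" f] by auto
      then show "of_bool (b l \<in> p ` f) - of_bool (m + b l \<in> p ` f) = (of_bool (l \<in> f) - of_bool (m + l \<in> f) :: real)"
        by simp
    qed
    finally show ?thesis .
  qed
  have "pattern_sum n k m T {} w \<sigma> = pattern_sum n k m S {} w (\<sigma> \<circ> p)" for \<sigma>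
    using sum_ksubsets_image[OF p, of "\<lambda>f. w (\<sigma> ` f) * pair_sign m T f" k]
    by (simp add: pattern_sum_def sign image_comp)
  then show ?thesis
    unfolding pattern_norm_def using sum_permutes_right[OF p, of "\<lambda>\<sigma>. \<bar>pattern_sum n k m S {} w \<sigma>\<bar>"] by simp
qed

text \<open>With \<open>J = {1..k}\<close> the pattern admits a single edge, and its image under a
  uniformly random permutation is a uniformly random edge.\<close>

lemma hnorm1_eq_pattern_norm:
  assumes "k \<le> n"
  shows "fact n * hnorm1 n k w = real (n choose k) * pattern_norm n k m {} {1..k} w"
proof -
  let ?V = "{1..n}"
  have sum: "pattern_sum n k m {} {1..k} w \<sigma> = w (\<sigma> ` {1..k})" for \<sigma>
  proof -
    have "{1..k} \<subseteq> f \<longleftrightarrow> f = {1..k}" if "f \<in> ksubsets ?V k" for f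
      using that card_subset_eq[of f "{1..k}"] by (auto simp: ksubsets_def finite_subset)
    then have "pattern_sum n k m {} {1..k} w \<sigma> = (\<Sum>f\<in>ksubsets ?V k. if f = {1..k} then w (\<sigma> ` {1..k}) else 0)"
      unfolding pattern_sum_def by (intro sum.cong) (auto simp: pair_sign_def)
    moreover have "{1..k} \<in> ksubsets ?V k" using assms by (auto simp: ksubsets_def)
    ultimately show ?thesis by simp
  qed
  have orbit: "(\<Sum>\<sigma> | \<sigma> permutes ?V. \<bar>w (\<sigma> ` f)\<bar>) = pattern_norm n k m {} {1..k} w" if "f \<in> ksubsets ?V k" for f
  proof -
    obtain p where p: "p permutes ?V" "p ` {1..k} = f"
      using ex_permutes_image_eq[of ?V "{1..k}" f thesis] \<open>f \<in> _\<close> assms by (auto simp: ksubsets_def)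
    then show ?thesis
      using sum_permutes_right[OF p(1), of "\<lambda>\<sigma>. \<bar>w (\<sigma> ` {1..k})\<bar>"]
      unfolding pattern_norm_def sum p(2)[symmetric] by (simp only: image_comp)
  qed
  have "fact n * hnorm1 n k w = (\<Sum>\<sigma> | \<sigma> permutes ?V. \<Sum>f\<in>ksubsets ?V k. \<bar>w f\<bar>)"
    by (simp add: hnorm1_def card_permutations)
  also have "\<dots> = (\<Sum>\<sigma> | \<sigma> permutes ?V. \<Sum>f\<in>ksubsets ?V k. \<bar>w (\<sigma> ` f)\<bar>)"
    by (rule sum.cong[OF refl], rule sum_ksubsets_image[symmetric]) simp
  also have "\<dots> = (\<Sum>f\<in>ksubsets ?V k. \<Sum>\<sigma> | \<sigma> permutes ?V. \<bar>w (\<sigma> ` f)\<bar>)"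
    by (rule sum.swap)
  also have "\<dots> = (\<Sum>f\<in>ksubsets ?V k. pattern_norm n k m {} {1..k} w)"
    by (rule sum.cong[OF refl orbit])
  also have "\<dots> = real (n choose k) * pattern_norm n k m {} {1..k} w"
    by (simp add: card_ksubsets)
  finally show ?thesis .
qed

text \<open>The index \<open>i\<close> found here determines the part of \<open>w\<close>. Expanding
  the norm gives \<open>2 ^ k\<close> terms; the one for \<open>T = {}\<close> is the total weight
  and vanishes, so a largest term has positive level or the norm is 0.\<close>

lemma exists_large_pattern_norm:
  assumes "1 \<le> k" "k \<le> m" "2 * m \<le> n" "hweight k w {1..n} = 0"
  obtains i where "i \<in> {1..k}"
    "\<And>S. S \<subseteq> {1..m} \<Longrightarrow> card S = i \<Longrightarrow>
      fact n * hnorm1 n k w \<le> 2 ^ k * real k ^ (2 * k) * real n ^ i * pattern_norm n k m S {} w"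
proof -
  have kn: "2 * k \<le> n" "k \<le> n" and n0: "real n > 0" using assms by auto
  let ?q = "real k ^ 2 / real n"
  \<comment> \<open>\<open>g T\<close> dominates the term of \<open>T\<close> in the expansion:
    \<open>n ^ k * (k ^ 2 / n) ^ (k - card T)\<close> is at most
    \<open>k ^ (2 * k) * n ^ card T\<close>.\<close>
  define g where "g = (\<lambda>T. real k ^ (2 * k) * real n ^ card T * pattern_norm n k m T {} w)"
  have zero: "g {} = 0"
  proof -
    have "pattern_sum n k m {} {} w \<sigma> = 0" if "\<sigma> permutes {1..n}" for \<sigma>
      using sum_ksubsets_image[OF that, of w k] assms(4)
      by (simp add: pattern_sum_def pair_sign_def hweight_def)
    then show ?thesis by (simp add: g_def pattern_norm_def)
  qed
  have fin: "finite (g ` Pow {1..k})" "g ` Pow {1..k} \<noteq> {}" by auto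
  obtain T where T: "T \<in> Pow {1..k}" "g T = Max (g ` Pow {1..k})"
    using Max_in[OF fin] by auto
  have max: "g T' \<le> g T" if "T' \<in> Pow {1..k}" for T'
    using that T(2) by simp
  have "fact n * hnorm1 n k w = real (n choose k) * pattern_norm n k m {} {1..k} w"
    by (rule hnorm1_eq_pattern_norm) (rule kn)
  also have "\<dots> \<le> real n ^ k * (\<Sum>T\<in>Pow {1..k}. ?q ^ (k - card T) * pattern_norm n k m T {} w)"
  proof (rule mult_mono)
    show "real (n choose k) \<le> real n ^ k"
      using binomial_le_pow[OF kn(2)] by (metis of_nat_le_iff of_nat_power)
    show "pattern_norm n k m {} {1..k} w \<le> (\<Sum>T\<in>Pow {1..k}. ?q ^ (k - card T) * pattern_norm n k m T {} w)"
      using pattern_norm_expand[of "{1..k}" m "{}" n k w] assms kn by auto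
  qed auto
  also have "\<dots> = (\<Sum>T\<in>Pow {1..k}. real n ^ k * ?q ^ (k - card T) * pattern_norm n k m T {} w)"
    by (simp add: sum_distrib_left mult.assoc)
  also have "\<dots> \<le> (\<Sum>T\<in>Pow {1..k}. g T)"
  proof (intro sum_mono)
    fix T assume "T \<in> Pow {1..k}"
    then have le: "card T \<le> k" using card_mono[of "{1..k}" T] by auto
    have "real n ^ k * ?q ^ (k - card T) = real n ^ card T * (real n ^ (k - card T) * ?q ^ (k - card T))"
      using le by (simp add: mult.assoc[symmetric] power_add[symmetric])
    also have "\<dots> = real n ^ card T * real k ^ (2 * (k - card T))"
      using n0 by (simp add: power_mult_distrib[symmetric] power_mult)
    also have "\<dots> \<le> real n ^ card T * real k ^ (2 * k)"
      using assms by (intro mult_left_mono power_increasing) auto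
    finally show "real n ^ k * ?q ^ (k - card T) * pattern_norm n k m T {} w \<le> g T"
      unfolding g_def by (intro mult_right_mono) (auto simp: mult.commute)
  qed
  also have "\<dots> \<le> 2 ^ k * g T"
    using sum_bounded_above[of "Pow {1..k}" g "g T"] max by (simp add: card_Pow)
  finally have le: "fact n * hnorm1 n k w \<le> 2 ^ k * g T" .
  show ?thesis
  proof (cases "T = {}")
    \<comment> \<open>Here the norm is 0, so any index serves; 1 is taken.\<close>
    case True
    show ?thesis
    proof (rule that[of 1])
      fix S assume "S \<subseteq> {1..m}" "card S = 1"
      have "fact n * hnorm1 n k w \<le> 0" using le zero True by simp
      also have "0 \<le> 2 ^ k * real k ^ (2 * k) * real n ^ 1 * pattern_norm n k m S {} w" by simp
      finally show "fact n * hnorm1 n k w \<le> 2 ^ k * real k ^ (2 * k) * real n ^ 1 * pattern_norm n k m S {} w" .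
    qed (use assms in auto)
  next
    case False
    have finT: "finite T" using T finite_subset by auto
    show ?thesis
    proof (rule that[of "card T"])
      show "card T \<in> {1..k}"
        using False finT T card_mono[of "{1..k}" T] by (auto simp: Suc_le_eq card_gt_0_iff)
      fix S assume S: "S \<subseteq> {1..m}" "card S = card T"
      have "T \<subseteq> {1..m}" using T assms by fastforce
      then have "pattern_norm n k m S {} w = pattern_norm n k m T {} w"
        using S assms by (intro pattern_norm_cong_card) auto
      then show "fact n * hnorm1 n k w \<le> 2 ^ k * real k ^ (2 * k) * real n ^ card T * pattern_norm n k m S {} w"
        using le by (simp add: g_def mult.assoc)
    qed
  qed
qed

section \<open>Walsh coefficients of the inner product\<close>

text \<open>The sum over \<open>S\<close> factorizes over the coordinates, and a coordinate where
  \<open>e\<close> and \<open>e'\<close> differ contributes the factor 0.\<close>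

lemma sum_walsh_walsh:
  assumes "finite M" "e \<subseteq> M" "e' \<subseteq> M"
  shows "(\<Sum>S\<in>Pow M. walsh S e * walsh S e') = (if e = e' then 2 ^ card M else 0)"
proof -
  define x where "x = (\<lambda>l. (if l \<in> e then - 1 else 1) * (if l \<in> e' then - 1 else 1 :: real))"
  have "(\<Sum>S\<in>Pow M. walsh S e * walsh S e') = (\<Sum>S\<in>Pow M. (\<Prod>l\<in>S. x l) * (\<Prod>l\<in>M - S. 1))"
    by (simp add: walsh_def x_def prod.distrib)
  also have "\<dots> = (\<Prod>l\<in>M. x l + 1)"
    using assms(1) by (rule prod_add[symmetric])
  also have "\<dots> = (if e = e' then 2 ^ card M else 0)"
  proof (cases "e = e'")
    case True
    then have "x l + 1 = 2" for l by (simp add: x_def)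
    then show ?thesis using True by simp
  next
    case False
    then obtain l where "l \<in> M" "(l \<in> e) \<noteq> (l \<in> e')" using assms(2,3) by blast
    then have "l \<in> M" "x l + 1 = 0" by (auto simp: x_def)
    then show ?thesis using assms(1) False by (simp add: prod_zero_iff) blast
  qed
  finally show ?thesis .
qed

definition walsh_coeff :: "'a set \<Rightarrow> ('a set \<Rightarrow> real) \<Rightarrow> 'a set \<Rightarrow> real" where
  "walsh_coeff M g S = (\<Sum>e\<in>Pow M. walsh S e * g e) / 2 ^ card M"

lemma wpoly_walsh_coeff:
  assumes "finite M" "e \<subseteq> M"
  shows "wpoly M (walsh_coeff M g) e = g e"
proof -
  have "2 ^ card M * wpoly M (walsh_coeff M g) e = (\<Sum>S\<in>Pow M. \<Sum>e'\<in>Pow M. walsh S e' * g e' * walsh S e)"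
    by (simp add: wpoly_def walsh_coeff_def sum_distrib_right sum_divide_distrib[symmetric])
  also have "\<dots> = (\<Sum>e'\<in>Pow M. g e' * (\<Sum>S\<in>Pow M. walsh S e' * walsh S e))"
    by (subst sum.swap) (simp add: sum_distrib_left mult_ac)
  also have "\<dots> = (\<Sum>e'\<in>Pow M. if e' = e then 2 ^ card M * g e else 0)"
    using assms by (intro sum.cong) (auto simp: sum_walsh_walsh)
  also have "\<dots> = 2 ^ card M * g e"
    using assms by simp
  finally show ?thesis by simp
qed

section \<open>Swaps of pairs as random signs\<close>

text \<open>The permutation \<open>\<tau>\<close> of the idea; a sign -1 at \<open>l\<close>, that
  is \<open>l \<in> e\<close>, means that the pair of \<open>l\<close> is swapped.\<close>

definition pair_swap :: "nat \<Rightarrow> nat set \<Rightarrow> nat \<Rightarrow> nat" where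
  "pair_swap m e x = (if x \<in> {1..m} \<and> x \<in> e then m + x
     else if x \<in> {m + 1..2 * m} \<and> x - m \<in> e then x - m else x)"

lemma pair_swap_simps:
  assumes "l \<in> {1..m}"
  shows "pair_swap m e l = (if l \<in> e then m + l else l)"
    "pair_swap m e (m + l) = (if l \<in> e then l else m + l)"
  using assms by (auto simp: pair_swap_def)

lemma pair_swap_outside: "x \<notin> {1..2 * m} \<Longrightarrow> pair_swap m e x = x"
  by (auto simp: pair_swap_def)

lemma pair_cases:
  fixes x m :: nat
  obtains "x \<in> {1..m}" | l where "l \<in> {1..m}" "x = m + l" | "x \<notin> {1..2 * m}"
proof -
  have "x \<in> {1..m} \<or> (x - m \<in> {1..m} \<and> x = m + (x - m)) \<or> x \<notin> {1..2 * m}" by auto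
  then show ?thesis using that by blast
qed

lemma pair_swap_pair_swap [simp]: "pair_swap m e (pair_swap m e x) = x"
  by (rule pair_cases[of x m]) (auto simp: pair_swap_simps pair_swap_outside)

lemma pair_swap_permutes:
  assumes "2 * m \<le> n"
  shows "pair_swap m e permutes {1..n}"
proof -
  have "pair_swap m e permutes {1..2 * m}"
    unfolding permutes_def
  proof (intro conjI allI impI)
    show "\<exists>!x. pair_swap m e x = y" for y
      by (rule ex1I[of _ "pair_swap m e y"]) auto
  qed (rule pair_swap_outside)
  then show ?thesis by (rule permutes_subset) (use assms in auto)
qed

definition toggle :: "'a \<Rightarrow> 'a set \<Rightarrow> 'a set" where
  "toggle l e = (if l \<in> e then e - {l} else insert l e)"

lemma toggle_toggle [simp]: "toggle l (toggle l e) = e"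
  by (auto simp: toggle_def)

lemma toggle_in_Pow: "l \<in> M \<Longrightarrow> e \<in> Pow M \<Longrightarrow> toggle l e \<in> Pow M"
  by (auto simp: toggle_def)

lemma mem_toggle: "x \<in> toggle l e \<longleftrightarrow> (if x = l then x \<notin> e else x \<in> e)"
  by (auto simp: toggle_def)

lemma pair_swap_toggle:
  assumes "l \<in> {1..m}"
  shows "pair_swap m (toggle l e) = pair_swap m e \<circ> pair_swap m {l}"
proof
  fix x
  show "pair_swap m (toggle l e) x = (pair_swap m e \<circ> pair_swap m {l}) x"
    by (rule pair_cases[of x m]) (use assms in \<open>auto simp: pair_swap_simps pair_swap_outside mem_toggle\<close>)
qed

lemma pair_swap_image_uncrossed:
  assumes "l \<in> {1..m}" "l \<in> f \<longleftrightarrow> m + l \<in> f"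
  shows "pair_swap m {l} ` f = f"
proof -
  have "pair_swap m {l} x \<in> f \<longleftrightarrow> x \<in> f" for x
    by (rule pair_cases[of x m]) (use assms in \<open>auto simp: pair_swap_simps pair_swap_outside\<close>)
  then show ?thesis
    by (metis (no_types, lifting) image_iff pair_swap_pair_swap subsetI subset_antisym)
qed

lemma walsh_toggle:
  assumes "finite S" "l \<in> S"
  shows "walsh S (toggle l e) = - walsh S e"
proof -
  have "(\<Prod>x\<in>S - {l}. if x \<in> toggle l e then - 1 else 1 :: real) = (\<Prod>x\<in>S - {l}. if x \<in> e then - 1 else 1)"
    by (intro prod.cong) (auto simp: mem_toggle)
  then show ?thesis
    unfolding walsh_def prod.remove[OF assms] by (simp add: mem_toggle)
qed

text \<open>Toggling \<open>l\<close> in \<open>e\<close> leaves the image of \<open>f\<close>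
  unchanged, since swapping an uncrossed pair preserves \<open>f\<close>, but reverses the Walsh
  sign; the terms cancel in pairs.\<close>

lemma sum_walsh_uncrossed:
  assumes "S \<subseteq> {1..m}" "l \<in> S" "l \<in> f \<longleftrightarrow> m + l \<in> f"
  shows "(\<Sum>e\<in>Pow {1..m}. walsh S e * g (pair_swap m e ` f)) = 0"
proof -
  have l: "l \<in> {1..m}" and fin: "finite S" using assms finite_subset by auto
  have img: "pair_swap m (toggle l e) ` f = pair_swap m e ` f" for e
    unfolding pair_swap_toggle[OF l] by (metis image_comp pair_swap_image_uncrossed[OF l assms(3)])
  have "(\<Sum>e\<in>Pow {1..m}. walsh S e * g (pair_swap m e ` f))
      = (\<Sum>e\<in>Pow {1..m}. walsh S (toggle l e) * g (pair_swap m (toggle l e) ` f))"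
    by (rule sum.reindex_bij_witness[of _ "toggle l" "toggle l"]) (simp_all only: toggle_toggle toggle_in_Pow[OF l])
  also have "\<dots> = (\<Sum>e\<in>Pow {1..m}. - (walsh S e * g (pair_swap m e ` f)))"
    by (simp only: walsh_toggle[OF fin assms(2)] img mult_minus_left)
  finally show ?thesis by (simp add: sum_negf)
qed

text \<open>The inner product for the permutation
  \<open>\<beta> \<circ> \<tau> \<circ> inv \<sigma>\<close>, as a function of the sign vector
  \<open>e\<close>, with edges pulled back to positions.\<close>

definition cross :: "nat \<Rightarrow> nat \<Rightarrow> nat \<Rightarrow> (nat set \<Rightarrow> real) \<Rightarrow> (nat set \<Rightarrow> real) \<Rightarrow>
    (nat \<Rightarrow> nat) \<Rightarrow> (nat \<Rightarrow> nat) \<Rightarrow> nat set \<Rightarrow> real" where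
  "cross n k m w u \<sigma> \<beta> e = (\<Sum>f\<in>ksubsets {1..n} k. w (\<sigma> ` f) * u (\<beta> ` pair_swap m e ` f))"

text \<open>This is the degree bound. An edge has \<open>k\<close> vertices and cannot cross more
  than \<open>k\<close> disjoint pairs, so every \<open>f\<close> leaves a pair of \<open>S\<close>
  uncrossed and its contribution cancels.\<close>

lemma cross_coeff_high:
  assumes "S \<subseteq> {1..m}" "k < card S"
  shows "walsh_coeff {1..m} (cross n k m w u \<sigma> \<beta>) S = 0"
proof -
  have "(\<Sum>e\<in>Pow {1..m}. walsh S e * cross n k m w u \<sigma> \<beta> e)
      = (\<Sum>f\<in>ksubsets {1..n} k. w (\<sigma> ` f) * (\<Sum>e\<in>Pow {1..m}. walsh S e * u (\<beta> ` pair_swap m e ` f)))"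
    unfolding cross_def sum_distrib_left by (subst sum.swap) (simp add: mult_ac)
  also have "\<dots> = 0"
  proof (rule sum.neutral, rule ballI)
    fix f assume f: "f \<in> ksubsets {1..n} k"
    have "\<exists>l\<in>S. l \<in> f \<longleftrightarrow> m + l \<in> f"
    proof (rule ccontr)
      assume "\<not> ?thesis"
      then have "card (f \<inter> (S \<union> (+) m ` S)) = card S"
        using assms(1) by (intro card_transversal) auto
      moreover have "card (f \<inter> (S \<union> (+) m ` S)) \<le> card f"
        using f by (intro card_mono) (auto simp: ksubsets_def finite_subset)
      ultimately show False using assms(2) f by (simp add: ksubsets_def)
    qed
    then obtain l where "l \<in> S" "l \<in> f \<longleftrightarrow> m + l \<in> f" by blast
    then have "(\<Sum>e\<in>Pow {1..m}. walsh S e * u (\<beta> ` pair_swap m e ` f)) = 0"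
      using sum_walsh_uncrossed[OF assms(1), of l f "\<lambda>f. u (\<beta> ` f)"] by simp
    then show "w (\<sigma> ` f) * (\<Sum>e\<in>Pow {1..m}. walsh S e * u (\<beta> ` pair_swap m e ` f)) = 0"
      by simp
  qed
  finally show ?thesis by (simp add: walsh_coeff_def)
qed

text \<open>Averaging the Walsh coefficient at \<open>S\<close> over this group, with sign, factorizes it: the group
  acts transitively on the edges that cross every pair indexed by \<open>S\<close>.\<close>

definition pair_group :: "nat \<Rightarrow> nat \<Rightarrow> nat set \<Rightarrow> (nat \<Rightarrow> nat) set" where
  "pair_group n m S = {h. h permutes {1..n} \<and>
     (\<forall>l\<in>S. (h l = l \<and> h (m + l) = m + l) \<or> (h l = m + l \<and> h (m + l) = l))}"

text \<open>On \<open>pair_group\<close> with \<open>S \<subseteq> {1..m}\<close> this is -1 to the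
  number of pairs of \<open>S\<close> that \<open>h\<close> swaps.\<close>

definition group_sign :: "nat set \<Rightarrow> (nat \<Rightarrow> nat) \<Rightarrow> real" where
  "group_sign S h = (\<Prod>l\<in>S. if h l = l then 1 else - 1)"

definition crossing :: "nat \<Rightarrow> nat \<Rightarrow> nat \<Rightarrow> nat set \<Rightarrow> nat set set" where
  "crossing n k m S = {f \<in> ksubsets {1..n} k. pair_sign m S f \<noteq> 0}"

lemma abs_group_sign [simp]: "\<bar>group_sign S h\<bar> = 1"
  unfolding group_sign_def abs_prod by (rule prod.neutral) auto

lemma finite_pair_group [simp]: "finite (pair_group n m S)"
  by (rule finite_subset[of _ "{h. h permutes {1..n}}"]) (auto simp: pair_group_def finite_permutations)

lemma id_in_pair_group [simp]: "id \<in> pair_group n m S"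
  by (simp add: pair_group_def permutes_id)

lemma pair_group_comp:
  assumes "h \<in> pair_group n m S" "h' \<in> pair_group n m S"
  shows "h \<circ> h' \<in> pair_group n m S"
proof -
  have "(h \<circ> h') permutes {1..n}"
    using assms by (simp add: pair_group_def permutes_compose)
  moreover have "((h \<circ> h') l = l \<and> (h \<circ> h') (m + l) = m + l) \<or> ((h \<circ> h') l = m + l \<and> (h \<circ> h') (m + l) = l)"
    if "l \<in> S" for l
    using assms that unfolding pair_group_def by fastforce
  ultimately show ?thesis by (simp add: pair_group_def)
qed

lemma pair_swap_in_pair_group:
  assumes "2 * m \<le> n" "S \<subseteq> {1..m}"
  shows "pair_swap m e \<in> pair_group n m S"
proof -
  have "l \<in> {1..m}" if "l \<in> S" for l using assms(2) that by blast
  then show ?thesis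
    unfolding pair_group_def using pair_swap_permutes[OF assms(1)] by (simp add: pair_swap_simps)
qed

lemma sum_pair_group_comp:
  assumes "h' \<in> pair_group n m S"
  shows "(\<Sum>h\<in>pair_group n m S. g (h \<circ> h')) = (\<Sum>h\<in>pair_group n m S. g h)"
proof -
  have surj: "surj h'" using assms permutes_surj by (auto simp: pair_group_def)
  have inj: "inj_on (\<lambda>h. h \<circ> h') (pair_group n m S)"
  proof (rule inj_onI)
    fix h1 h2 assume "h1 \<circ> h' = h2 \<circ> h'"
    then have "h1 \<circ> (h' \<circ> inv h') = h2 \<circ> (h' \<circ> inv h')" by (metis comp_assoc)
    then show "h1 = h2" using surj by (simp add: surj_iff)
  qed
  have "(\<lambda>h. h \<circ> h') ` pair_group n m S = pair_group n m S"
    by (rule endo_inj_surj[OF _ _ inj]) (use assms pair_group_comp in auto)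
  then show ?thesis
    using sum.reindex[OF inj, of g] by (simp add: o_def)
qed

lemma group_sign_comp_pair_swap:
  assumes "h \<in> pair_group n m S" "S \<subseteq> {1..m}"
  shows "group_sign S (h \<circ> pair_swap m e) = group_sign S h * walsh S e"
  unfolding group_sign_def walsh_def prod.distrib[symmetric]
proof (rule prod.cong[OF refl])
  fix l assume l: "l \<in> S"
  then have "l \<in> {1..m}" using assms by auto
  moreover have "(h l = l \<and> h (m + l) = m + l) \<or> (h l = m + l \<and> h (m + l) = l)"
    using assms l by (auto simp: pair_group_def)
  ultimately show "(if (h \<circ> pair_swap m e) l = l then 1 else - 1)
      = (if h l = l then 1 else - 1) * (if l \<in> e then - 1 else 1 :: real)"
    by (auto simp: pair_swap_simps)
qed

lemma pair_sign_pair_group: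
  assumes "h \<in> pair_group n m S" "S \<subseteq> {1..m}"
  shows "pair_sign m S (h ` f) = group_sign S h * pair_sign m S f"
  unfolding group_sign_def pair_sign_def prod.distrib[symmetric]
proof (rule prod.cong[OF refl])
  fix l assume l: "l \<in> S"
  then have "l \<in> {1..m}" using assms by auto
  have inj: "inj h" using assms permutes_inj by (auto simp: pair_group_def)
  have mem: "h l \<in> h ` f \<longleftrightarrow> l \<in> f" "h (m + l) \<in> h ` f \<longleftrightarrow> m + l \<in> f"
    by (rule inj_image_mem_iff[OF inj])+
  have "(h l = l \<and> h (m + l) = m + l) \<or> (h l = m + l \<and> h (m + l) = l)"
    using assms l by (auto simp: pair_group_def)
  then show "of_bool (l \<in> h ` f) - of_bool (m + l \<in> h ` f)
      = (if h l = l then 1 else - 1) * (of_bool (l \<in> f) - of_bool (m + l \<in> f) :: real)"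
  proof (elim disjE conjE)
    assume "h l = l" "h (m + l) = m + l"
    then show ?thesis using mem by simp
  next
    assume "h l = m + l" "h (m + l) = l"
    then show ?thesis using mem \<open>l \<in> {1..m}\<close> by simp
  qed
qed

text \<open>First swap the pairs of \<open>S\<close> in which \<open>f\<close> and \<open>g\<close>
  contain different vertices, then permute the remaining positions; there both edges have
  \<open>k - card S\<close> vertices.\<close>

lemma pair_group_transitive:
  assumes S: "S \<subseteq> {1..m}" "2 * m \<le> n" and f: "f \<in> crossing n k m S" and g: "g \<in> crossing n k m S"
  obtains h where "h \<in> pair_group n m S" "h ` f = g"
proof -
  have finS: "finite S" using S finite_subset by auto
  define Q where "Q = S \<union> (+) m ` S"
  define C where "C = {1..n} - Q"
  have card: "card (f \<inter> C) = k - card S" "finite f" "f \<subseteq> {1..n}" "card f = k"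
    if "f \<in> crossing n k m S" for f
  proof -
    show f: "f \<subseteq> {1..n}" "card f = k" and fin: "finite f"
      using that by (auto simp: crossing_def ksubsets_def finite_subset)
    have "card (f \<inter> Q) = card S"
      unfolding Q_def using that S finS
      by (intro card_transversal) (auto simp: crossing_def pair_sign_nonzero_iff)
    moreover have "f \<inter> C = f - (f \<inter> Q)" using f by (auto simp: C_def)
    ultimately show "card (f \<inter> C) = k - card S"
      using f fin by (simp add: card_Diff_subset)
  qed
  have "card (f \<inter> C) = card (g \<inter> C)" using card(1) f g by simp
  then obtain p where p: "p permutes C" "p ` (f \<inter> C) = g \<inter> C"
    by (rule ex_permutes_image_eq[of C "f \<inter> C" "g \<inter> C", rotated 3]) (auto simp: C_def)
  define e where "e = {l \<in> S. l \<in> f \<longleftrightarrow> l \<notin> g}"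
  define h where "h = p \<circ> pair_swap m e"
  have pQ: "p x = x" if "x \<in> Q" for x
    using p(1) that by (auto simp: permutes_def C_def)
  have pV: "p permutes {1..n}" using p(1) by (rule permutes_subset) (auto simp: C_def)
  then have "p \<in> pair_group n m S"
    using pQ by (auto simp: pair_group_def Q_def)
  then have h: "h \<in> pair_group n m S"
    unfolding h_def using S by (intro pair_group_comp pair_swap_in_pair_group)
  have trans: "l \<in> f \<longleftrightarrow> m + l \<notin> f" "l \<in> g \<longleftrightarrow> m + l \<notin> g" if "l \<in> S" for l
    using f g that finS by (auto simp: crossing_def pair_sign_nonzero_iff)
  have "h ` f \<subseteq> g"
  proof (rule image_subsetI)
    fix x assume x: "x \<in> f"
    consider (C) "x \<in> C" | (S) "x \<in> S" | (mS) l where "l \<in> S" "x = m + l"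
      using x card(3)[OF f] unfolding C_def Q_def by blast
    then show "h x \<in> g"
    proof cases
      case C
      have "pair_swap m e x = x"
      proof (rule pair_cases[of x m])
        assume "x \<in> {1..m}"
        then show ?thesis using C by (auto simp: pair_swap_simps e_def C_def Q_def)
      next
        fix l assume "l \<in> {1..m}" "x = m + l"
        then show ?thesis using C by (auto simp: pair_swap_simps e_def C_def Q_def)
      qed (rule pair_swap_outside)
      then show ?thesis using p(2) C x by (auto simp: h_def)
    next
      case S
      then have "x \<in> {1..m}" using assms(1) by auto
      then show ?thesis
        using S x trans[OF S] pQ[of x] pQ[of "m + x"]
        by (auto simp: h_def pair_swap_simps e_def Q_def)
    next
      case mS
      then have "l \<in> {1..m}" using assms(1) by auto
      then show ?thesis
        using mS x trans[OF mS(1)] pQ[of l] pQ[of "m + l"]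
        by (auto simp: h_def pair_swap_simps e_def Q_def)
    qed
  qed
  moreover have "card (h ` f) = card g"
  proof -
    have "inj h" using h permutes_inj by (auto simp: pair_group_def)
    then have "card (h ` f) = card f" by (intro card_image) (rule inj_on_subset, auto)
    then show ?thesis using card(4) f g by simp
  qed
  ultimately have "h ` f = g" using card(2)[OF g] by (intro card_subset_eq) auto
  with h show ?thesis by (rule that)
qed

text \<open>By transitivity the group sum is the same for every crossing edge. Summing it over all
  of them and exchanging the sums lets each \<open>h\<close> permute the edges.\<close>

lemma sum_pair_group_image:
  assumes S: "S \<subseteq> {1..m}" "2 * m \<le> n" and f: "f \<in> crossing n k m S"
  shows "real (card (crossing n k m S)) * (\<Sum>h\<in>pair_group n m S. pair_sign m S (h ` f) * u (h ` f))
    = real (card (pair_group n m S)) * (\<Sum>g\<in>ksubsets {1..n} k. u g * pair_sign m S g)"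
proof -
  define F where "F = (\<lambda>g. pair_sign m S g * u g)"
  let ?H = "pair_group n m S" and ?X = "crossing n k m S" and ?K = "ksubsets {1..n} k"
  have "(\<Sum>h\<in>?H. F (h ` g)) = (\<Sum>h\<in>?H. F (h ` f))" if g: "g \<in> ?X" for g
  proof -
    obtain h' where h': "h' \<in> ?H" "h' ` f = g"
      using pair_group_transitive[OF S f g] .
    show ?thesis
      using sum_pair_group_comp[OF h'(1), of "\<lambda>h. F (h ` f)"]
      by (simp only: image_comp h'(2)[symmetric])
  qed
  then have "real (card ?X) * (\<Sum>h\<in>?H. F (h ` f)) = (\<Sum>g\<in>?X. \<Sum>h\<in>?H. F (h ` g))"
    by simp
  also have "\<dots> = (\<Sum>g\<in>?K. \<Sum>h\<in>?H. F (h ` g))"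
    by (rule sum.mono_neutral_left)
      (use S in \<open>auto simp: crossing_def F_def pair_sign_pair_group intro!: sum.neutral\<close>)
  also have "\<dots> = (\<Sum>h\<in>?H. \<Sum>g\<in>?K. F (h ` g))" by (rule sum.swap)
  also have "\<dots> = (\<Sum>h\<in>?H. \<Sum>g\<in>?K. F g)"
    by (rule sum.cong[OF refl], rule sum_ksubsets_image) (simp add: pair_group_def)
  finally show ?thesis by (simp add: F_def mult.commute)
qed

lemma sum_group_sign_image:
  assumes S: "S \<subseteq> {1..m}" "2 * m \<le> n" and f: "f \<in> ksubsets {1..n} k"
  shows "real (card (crossing n k m S)) * (\<Sum>h\<in>pair_group n m S. group_sign S h * u (h ` f))
    = real (card (pair_group n m S)) * pair_sign m S f * (\<Sum>g\<in>ksubsets {1..n} k. u g * pair_sign m S g)"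
proof (cases "pair_sign m S f = 0")
  case True
  have finS: "finite S" using S finite_subset by auto
  then obtain l where l: "l \<in> S" "l \<in> f \<longleftrightarrow> m + l \<in> f"
    using True pair_sign_nonzero_iff by blast
  have lm: "l \<in> {1..m}" using l S by auto
  have "(\<Sum>h\<in>pair_group n m S. group_sign S h * u (h ` f))
      = (\<Sum>h\<in>pair_group n m S. group_sign S (h \<circ> pair_swap m {l}) * u ((h \<circ> pair_swap m {l}) ` f))"
    using sum_pair_group_comp[OF pair_swap_in_pair_group[OF S(2,1)], of "\<lambda>h. group_sign S h * u (h ` f)" "{l}"] by simp
  also have "\<dots> = (\<Sum>h\<in>pair_group n m S. - (group_sign S h * u (h ` f)))"
  proof (rule sum.cong[OF refl])
    fix h assume "h \<in> pair_group n m S"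
    moreover have "walsh S {l} = - 1"
      using walsh_toggle[OF finS l(1), of "{}"] by (simp add: toggle_def walsh_def)
    moreover have "(h \<circ> pair_swap m {l}) ` f = h ` f"
      by (simp only: image_comp[symmetric] pair_swap_image_uncrossed[OF lm l(2)])
    ultimately show "group_sign S (h \<circ> pair_swap m {l}) * u ((h \<circ> pair_swap m {l}) ` f) = - (group_sign S h * u (h ` f))"
      using S by (simp only: group_sign_comp_pair_swap)
  qed
  finally show ?thesis using True by (simp add: sum_negf)
next
  case False
  have sq: "pair_sign m S f * pair_sign m S f = 1"
    using False S finite_subset[OF S(1)] unfolding pair_sign_def prod.distrib[symmetric]
    by (intro prod.neutral) (auto simp: prod_zero_iff of_bool_def split: if_splits)
  have "(\<Sum>h\<in>pair_group n m S. group_sign S h * u (h ` f))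
      = pair_sign m S f * (\<Sum>h\<in>pair_group n m S. pair_sign m S (h ` f) * u (h ` f))"
    unfolding sum_distrib_left
  proof (rule sum.cong[OF refl])
    fix h assume "h \<in> pair_group n m S"
    then have "pair_sign m S f * pair_sign m S (h ` f) = group_sign S h"
      using S sq by (simp add: pair_sign_pair_group)
    then show "group_sign S h * u (h ` f) = pair_sign m S f * (pair_sign m S (h ` f) * u (h ` f))"
      by (simp add: mult.assoc[symmetric])
  qed
  then show ?thesis
    using sum_pair_group_image[OF S, of f k u] False f by (simp add: crossing_def mult_ac)
qed

text \<open>The Walsh sign is absorbed by the group sign of \<open>h \<circ> pair_swap m e\<close>,
  so each \<open>e\<close> yields the same group sum. Averaging over the group then separates the
  edge seen by \<open>w\<close> from the edge seen by \<open>u\<close>.\<close>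

lemma sum_group_sign_cross_coeff:
  assumes S: "S \<subseteq> {1..m}" "2 * m \<le> n"
  shows "real (card (crossing n k m S)) *
      (\<Sum>h\<in>pair_group n m S. group_sign S h * walsh_coeff {1..m} (cross n k m w u \<sigma> (\<beta> \<circ> h)) S)
    = real (card (pair_group n m S)) * (pattern_sum n k m S {} w \<sigma> * pattern_sum n k m S {} u \<beta>)"
proof -
  let ?H = "pair_group n m S" and ?K = "ksubsets {1..n} k"
  define G where "G = (\<lambda>h. group_sign S h * (\<Sum>f\<in>?K. w (\<sigma> ` f) * u (\<beta> ` h ` f)))"
  have "2 ^ m * (\<Sum>h\<in>?H. group_sign S h * walsh_coeff {1..m} (cross n k m w u \<sigma> (\<beta> \<circ> h)) S)
      = (\<Sum>h\<in>?H. \<Sum>e\<in>Pow {1..m}. G (h \<circ> pair_swap m e))"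
    unfolding sum_distrib_left
  proof (rule sum.cong[OF refl])
    fix h assume h: "h \<in> ?H"
    have "2 ^ m * walsh_coeff {1..m} g S = (\<Sum>e\<in>Pow {1..m}. walsh S e * g e)" for g
      by (simp add: walsh_coeff_def)
    then have "2 ^ m * (group_sign S h * walsh_coeff {1..m} (cross n k m w u \<sigma> (\<beta> \<circ> h)) S)
        = group_sign S h * (\<Sum>e\<in>Pow {1..m}. walsh S e * cross n k m w u \<sigma> (\<beta> \<circ> h) e)"
      by (simp only: mult.left_commute)
    also have "\<dots> = (\<Sum>e\<in>Pow {1..m}. G (h \<circ> pair_swap m e))"
      unfolding G_def group_sign_comp_pair_swap[OF h S(1)] cross_def image_comp comp_assoc sum_distrib_left[of "group_sign S h"]
      by (simp only: mult.assoc)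
    finally show "2 ^ m * (group_sign S h * walsh_coeff {1..m} (cross n k m w u \<sigma> (\<beta> \<circ> h)) S)
        = (\<Sum>e\<in>Pow {1..m}. G (h \<circ> pair_swap m e))" .
  qed
  also have "\<dots> = (\<Sum>e\<in>Pow {1..m}. \<Sum>h\<in>?H. G h)"
    by (subst sum.swap) (simp add: sum_pair_group_comp[OF pair_swap_in_pair_group[OF S(2,1)]])
  also have "\<dots> = 2 ^ m * (\<Sum>f\<in>?K. w (\<sigma> ` f) * (\<Sum>h\<in>?H. group_sign S h * u (\<beta> ` h ` f)))"
    unfolding G_def sum_distrib_left by (subst sum.swap) (simp add: card_Pow sum_distrib_left mult_ac)
  finally have "(\<Sum>h\<in>?H. group_sign S h * walsh_coeff {1..m} (cross n k m w u \<sigma> (\<beta> \<circ> h)) S)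
      = (\<Sum>f\<in>?K. w (\<sigma> ` f) * (\<Sum>h\<in>?H. group_sign S h * u (\<beta> ` h ` f)))"
    by simp
  then have "real (card (crossing n k m S)) *
      (\<Sum>h\<in>?H. group_sign S h * walsh_coeff {1..m} (cross n k m w u \<sigma> (\<beta> \<circ> h)) S)
      = (\<Sum>f\<in>?K. w (\<sigma> ` f) * (real (card (crossing n k m S)) * (\<Sum>h\<in>?H. group_sign S h * u (\<beta> ` h ` f))))"
    by (simp add: sum_distrib_left mult_ac)
  also have "\<dots> = (\<Sum>f\<in>?K. w (\<sigma> ` f) * (real (card ?H) * pair_sign m S f * pattern_sum n k m S {} u \<beta>))"
  proof (rule sum.cong[OF refl])
    fix f assume "f \<in> ?K"
    from sum_group_sign_image[OF S this, of "\<lambda>f. u (\<beta> ` f)"]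
    have "real (card (crossing n k m S)) * (\<Sum>h\<in>?H. group_sign S h * u (\<beta> ` h ` f))
        = real (card ?H) * pair_sign m S f * pattern_sum n k m S {} u \<beta>"
      by (simp add: pattern_sum_def)
    then show "w (\<sigma> ` f) * (real (card (crossing n k m S)) * (\<Sum>h\<in>?H. group_sign S h * u (\<beta> ` h ` f)))
        = w (\<sigma> ` f) * (real (card ?H) * pair_sign m S f * pattern_sum n k m S {} u \<beta>)"
      by (rule arg_cong)
  qed
  also have "\<dots> = real (card ?H) * (pattern_sum n k m S {} w \<sigma> * pattern_sum n k m S {} u \<beta>)"
    unfolding pattern_sum_def[of _ _ _ _ _ w] by (simp add: sum_distrib_left sum_distrib_right mult_ac)
  finally show ?thesis .
qed

text \<open>The convexity step: the triangle inequality moves the absolute value inside the group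
  average, and for fixed \<open>h\<close> the permutation \<open>\<beta> \<circ> h\<close> runs over
  all permutations as \<open>\<beta>\<close> does.\<close>

lemma pattern_norm_mult_le:
  assumes S: "S \<subseteq> {1..m}" "2 * m \<le> n"
  shows "pattern_norm n k m S {} w * pattern_norm n k m S {} u \<le>
    real (card (crossing n k m S)) *
    (\<Sum>\<sigma> | \<sigma> permutes {1..n}. \<Sum>\<beta> | \<beta> permutes {1..n}. \<bar>walsh_coeff {1..m} (cross n k m w u \<sigma> \<beta>) S\<bar>)"
proof -
  let ?H = "pair_group n m S" and ?P = "{\<sigma>. \<sigma> permutes {1..n}}"
  define N where "N = real (card ?H)"
  define X where "X = real (card (crossing n k m S))"
  define c where "c = (\<lambda>\<sigma> \<beta>. walsh_coeff {1..m} (cross n k m w u \<sigma> \<beta>) S)"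
  have "?H \<noteq> {}" using id_in_pair_group by blast
  then have N: "N > 0" by (simp add: N_def card_gt_0_iff)
  have X: "X \<ge> 0" by (simp add: X_def)
  have "N * (pattern_norm n k m S {} w * pattern_norm n k m S {} u)
      = (\<Sum>\<sigma>\<in>?P. \<Sum>\<beta>\<in>?P. \<bar>N * (pattern_sum n k m S {} w \<sigma> * pattern_sum n k m S {} u \<beta>)\<bar>)"
    unfolding pattern_norm_def sum_product using N by (simp add: sum_distrib_left abs_mult)
  also have "\<dots> = (\<Sum>\<sigma>\<in>?P. \<Sum>\<beta>\<in>?P. X * \<bar>\<Sum>h\<in>?H. group_sign S h * c \<sigma> (\<beta> \<circ> h)\<bar>)"
    unfolding N_def c_def sum_group_sign_cross_coeff[OF S, symmetric] by (simp add: abs_mult X_def)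
  also have "\<dots> \<le> (\<Sum>\<sigma>\<in>?P. \<Sum>\<beta>\<in>?P. X * (\<Sum>h\<in>?H. \<bar>c \<sigma> (\<beta> \<circ> h)\<bar>))"
    using X by (intro sum_mono mult_left_mono order_trans[OF sum_abs]) (auto simp: abs_mult)
  also have "\<dots> = X * (\<Sum>\<sigma>\<in>?P. \<Sum>h\<in>?H. \<Sum>\<beta>\<in>?P. \<bar>c \<sigma> (\<beta> \<circ> h)\<bar>)"
    by (subst (2) sum.swap) (simp add: sum_distrib_left)
  also have "\<dots> = X * (\<Sum>\<sigma>\<in>?P. \<Sum>h\<in>?H. \<Sum>\<beta>\<in>?P. \<bar>c \<sigma> \<beta>\<bar>)"
  proof -
    have "(\<Sum>\<beta>\<in>?P. \<bar>c \<sigma> (\<beta> \<circ> h)\<bar>) = (\<Sum>\<beta>\<in>?P. \<bar>c \<sigma> \<beta>\<bar>)" if "h \<in> ?H" for \<sigma> h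
      using that by (intro sum_permutes_right) (simp add: pair_group_def)
    then show ?thesis by simp
  qed
  also have "\<dots> = N * (X * (\<Sum>\<sigma>\<in>?P. \<Sum>\<beta>\<in>?P. \<bar>c \<sigma> \<beta>\<bar>))"
    by (simp add: N_def sum_distrib_left mult_ac)
  finally show ?thesis using N by (simp add: X_def c_def)
qed

section \<open>Counting crossing edges and reindexing the inner product\<close>

text \<open>A crossing edge is determined by its choice in each pair of \<open>S\<close> together
  with its \<open>k - card S\<close> vertices outside these pairs.\<close>

lemma card_crossing_le:
  assumes "S \<subseteq> {1..m}" "2 * m \<le> n" "card S \<le> k"
  shows "card (crossing n k m S) \<le> 2 ^ card S * n ^ (k - card S)"
proof -
  have finS: "finite S" using assms finite_subset by auto
  define Q where "Q = S \<union> (+) m ` S"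
  define C where "C = {1..n} - Q"
  have C: "finite C" "card C \<le> n"
    using card_mono[of "{1..n}" C] by (auto simp: C_def)
  let ?\<phi> = "\<lambda>f. (f \<inter> S, f \<inter> C)"
  have tr: "l \<in> f \<longleftrightarrow> m + l \<notin> f" if "f \<in> crossing n k m S" "l \<in> S" for l f
    using that finS by (auto simp: crossing_def pair_sign_nonzero_iff)
  have sub: "f \<subseteq> {1..n}" "card f = k" "finite f" if "f \<in> crossing n k m S" for f
    using that by (auto simp: crossing_def ksubsets_def finite_subset)
  have "inj_on ?\<phi> (crossing n k m S)"
  proof (rule inj_onI)
    fix f g assume f: "f \<in> crossing n k m S" and g: "g \<in> crossing n k m S" and eq: "?\<phi> f = ?\<phi> g"
    have memS: "x \<in> f \<longleftrightarrow> x \<in> g" if "x \<in> S" for x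
      using eq that by (auto simp: set_eq_iff)
    have memC: "x \<in> f \<longleftrightarrow> x \<in> g" if "x \<in> C" for x
      using eq that by (auto simp: set_eq_iff)
    have "x \<in> f \<longleftrightarrow> x \<in> g" for x
    proof -
      consider "x \<notin> {1..n}" | "x \<in> C" | "x \<in> S" | l where "l \<in> S" "x = m + l"
        unfolding C_def Q_def by blast
      then show ?thesis
      proof cases
        case 1
        then show ?thesis using sub(1)[OF f] sub(1)[OF g] by blast
      next
        case 4
        then show ?thesis using tr[OF f] tr[OF g] memS by simp
      qed (use memS memC in simp_all)
    qed
    then show "f = g" by blast
  qed
  moreover have "?\<phi> ` crossing n k m S \<subseteq> Pow S \<times> ksubsets C (k - card S)"
  proof (rule image_subsetI)
    fix f assume f: "f \<in> crossing n k m S"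
    have "card (f \<inter> Q) = card S"
      unfolding Q_def using tr[OF f] assms by (intro card_transversal) auto
    moreover have "f \<inter> C = f - (f \<inter> Q)" using sub(1)[OF f] by (auto simp: C_def)
    ultimately have "card (f \<inter> C) = k - card S"
      using sub[OF f] by (simp add: card_Diff_subset)
    then show "?\<phi> f \<in> Pow S \<times> ksubsets C (k - card S)" by (auto simp: ksubsets_def)
  qed
  ultimately have "card (crossing n k m S) \<le> card (Pow S \<times> ksubsets C (k - card S))"
    using finS C by (intro card_inj_on_le) auto
  also have "\<dots> = 2 ^ card S * (card C choose (k - card S))"
    using finS C by (simp add: card_cartesian_product card_Pow card_ksubsets)
  also have "(card C choose (k - card S)) \<le> card C ^ (k - card S)"
    by (cases "k - card S \<le> card C") (auto simp: binomial_le_pow binomial_eq_0)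
  also have "\<dots> \<le> n ^ (k - card S)" using C by (intro power_mono) auto
  finally show ?thesis by simp
qed

text \<open>Substitutes \<open>p\<close> f\<open>for the edge, with\<close>p = \<beta> \<circ>
  pair_swap m e\<open>; the inverse of the full permutation takes it to\<close>\<sigma>
  \<open>f\<close>.\<close>

lemma hinner_eq_cross:
  assumes \<sigma>: "\<sigma> permutes {1..n}" and \<beta>: "\<beta> permutes {1..n}" and m: "2 * m \<le> n"
  shows "hinner n k (hperm (\<beta> \<circ> (pair_swap m e \<circ> inv \<sigma>)) w) u = cross n k m w u \<sigma> \<beta> e"
proof -
  define p where "p = \<beta> \<circ> pair_swap m e"
  define \<pi> where "\<pi> = p \<circ> inv \<sigma>"
  have p: "p permutes {1..n}"
    unfolding p_def using \<beta> m by (intro permutes_compose pair_swap_permutes)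
  have \<pi>: "\<pi> permutes {1..n}"
    unfolding \<pi>_def using p \<sigma> by (intro permutes_compose permutes_inv)
  have "inv \<pi> (p x) = \<sigma> x" for x
    using \<pi> \<sigma> by (intro inv_f_eq permutes_inj) (auto simp: \<pi>_def permutes_inverses)
  then have "inv \<pi> ` p ` f = \<sigma> ` f" for f
    by (simp add: image_image)
  then have "hinner n k (hperm \<pi> w) u = cross n k m w u \<sigma> \<beta> e"
    using sum_ksubsets_image[OF p, of "\<lambda>f. w (inv \<pi> ` f) * u f" k]
    unfolding hinner_def hperm_def cross_def p_def image_comp by (simp add: comp_assoc)
  then show ?thesis by (simp add: \<pi>_def p_def comp_assoc)
qed

section \<open>The partition\<close>

definition level_sum :: "nat \<Rightarrow> nat \<Rightarrow> nat \<Rightarrow> (nat set \<Rightarrow> real) \<Rightarrow> (nat set \<Rightarrow> real) \<Rightarrow> nat \<Rightarrow>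
    (nat \<Rightarrow> nat) \<Rightarrow> (nat \<Rightarrow> nat) \<Rightarrow> real" where
  "level_sum n k m w u i \<sigma> \<beta> =
    (\<Sum>S | S \<subseteq> {1..m} \<and> card S = i. \<bar>walsh_coeff {1..m} (cross n k m w u \<sigma> \<beta>) S\<bar>)"

text \<open>The number of level \<open>i\<close> sets is of order \<open>n ^ i\<close>, with a
  constant depending on \<open>k\<close> only; \<open>n \<le> 3 * m\<close> absorbs the rounding in
  \<open>n div 2\<close>.\<close>

lemma power_le_binomial_half:
  assumes "1 \<le> i" "i \<le> k" "2 * k \<le> n"
  shows "real n ^ i \<le> (3 * real k) ^ k * real (n div 2 choose i)"
proof -
  define m where "m = n div 2"
  have "2 \<le> n" using assms by linarith
  then have im: "i \<le> m" "n \<le> 3 * m" unfolding m_def using assms by linarith+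
  have "real n \<le> 3 * real m" using im(2) by linarith
  then have "real n ^ i \<le> (3 * real m) ^ i" by (intro power_mono) auto
  also have "(3 * real m) ^ i = (3 * real i) ^ i * (real m / real i) ^ i"
  proof -
    have "3 * real m = (3 * real i) * (real m / real i)" using assms by simp
    then show ?thesis by (simp only: power_mult_distrib)
  qed
  also have "\<dots> \<le> (3 * real k) ^ k * real (m choose i)"
  proof (rule mult_mono)
    have "(3 * real i) ^ i \<le> (3 * real k) ^ i" using assms by (intro power_mono) auto
    also have "\<dots> \<le> (3 * real k) ^ k" using assms by (intro power_increasing) auto
    finally show "(3 * real i) ^ i \<le> (3 * real k) ^ k" .
    show "(real m / real i) ^ i \<le> real (m choose i)"
      by (rule binomial_ge_n_over_k_pow_k) (rule im)
  qed auto
  finally show ?thesis by (simp add: m_def)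
qed

lemma hnorm1_nonneg [simp]: "0 \<le> hnorm1 n k w"
  by (simp add: hnorm1_def sum_nonneg)

text \<open>Each norm costs \<open>n ^ i\<close> and the crossing edges cost
  \<open>n ^ (k - i)\<close>. Summing over the sets \<open>S\<close> of level \<open>i\<close>,
  about \<open>n ^ i\<close> of them, recovers one factor \<open>n ^ i\<close> and leaves
  \<open>n ^ k\<close>.\<close>

lemma hnorm1_mult_le_level_sum:
  assumes i: "1 \<le> i" "i \<le> k" and n: "2 * k \<le> n" and m: "m = n div 2" and C: "0 \<le> C"
    and w: "\<And>S. S \<subseteq> {1..m} \<Longrightarrow> card S = i \<Longrightarrow> fact n * hnorm1 n k w \<le> C * real n ^ i * pattern_norm n k m S {} w"
    and u: "\<And>S. S \<subseteq> {1..m} \<Longrightarrow> card S = i \<Longrightarrow> fact n * hnorm1 n k u \<le> C * real n ^ i * pattern_norm n k m S {} u"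
  shows "(fact n)\<^sup>2 * (hnorm1 n k w * hnorm1 n k u) \<le> C\<^sup>2 * 2 ^ k * (3 * real k) ^ k * real n ^ k *
    (\<Sum>\<sigma> | \<sigma> permutes {1..n}. \<Sum>\<beta> | \<beta> permutes {1..n}. level_sum n k m w u i \<sigma> \<beta>)"
proof -
  let ?P = "{\<sigma>. \<sigma> permutes {1..n}}" and ?L = "{S. S \<subseteq> {1..m} \<and> card S = i}"
  define T where "T = (\<lambda>S. \<Sum>\<sigma>\<in>?P. \<Sum>\<beta>\<in>?P. \<bar>walsh_coeff {1..m} (cross n k m w u \<sigma> \<beta>) S\<bar>)"
  define A where "A = (fact n)\<^sup>2 * (hnorm1 n k w * hnorm1 n k u)"
  have T0: "T S \<ge> 0" for S by (simp add: T_def sum_nonneg)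
  have A0: "A \<ge> 0" by (simp add: A_def)
  have n0: "real n > 0" and m2: "2 * m \<le> n" unfolding m using i n by linarith+
  have "A \<le> C\<^sup>2 * 2 ^ k * real n ^ (k + i) * T S" if S: "S \<in> ?L" for S
  proof -
    have S': "S \<subseteq> {1..m}" "card S = i" using S by auto
    have "A = (fact n * hnorm1 n k w) * (fact n * hnorm1 n k u)"
      by (simp add: A_def power2_eq_square)
    also have "\<dots> \<le> (C * real n ^ i * pattern_norm n k m S {} w) * (C * real n ^ i * pattern_norm n k m S {} u)"
      using C by (intro mult_mono w u S') auto
    also have "\<dots> = (C\<^sup>2 * real n ^ (i + i)) * (pattern_norm n k m S {} w * pattern_norm n k m S {} u)"
      by (simp add: power2_eq_square power_add)
    also have "\<dots> \<le> (C\<^sup>2 * real n ^ (i + i)) * (real (card (crossing n k m S)) * T S)"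
      unfolding T_def by (intro mult_left_mono pattern_norm_mult_le S' m2) auto
    also have "\<dots> \<le> (C\<^sup>2 * real n ^ (i + i)) * ((2 ^ k * real n ^ (k - i)) * T S)"
    proof (intro mult_left_mono mult_right_mono T0)
      have "card (crossing n k m S) \<le> 2 ^ i * n ^ (k - i)"
        using card_crossing_le[OF S'(1) m2, of k] S'(2) i by simp
      then have "real (card (crossing n k m S)) \<le> 2 ^ i * real n ^ (k - i)"
        using of_nat_mono[where 'a = real] by fastforce
      also have "\<dots> \<le> 2 ^ k * real n ^ (k - i)"
        using i by (intro mult_right_mono power_increasing) auto
      finally show "real (card (crossing n k m S)) \<le> 2 ^ k * real n ^ (k - i)" .
    qed auto
    also have "\<dots> = C\<^sup>2 * 2 ^ k * (real n ^ (i + i) * real n ^ (k - i)) * T S"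
      by simp
    also have "real n ^ (i + i) * real n ^ (k - i) = real n ^ (k + i)"
      using i by (simp add: add.commute flip: power_add)
    finally show ?thesis .
  qed
  then have "(\<Sum>S\<in>?L. A) \<le> (\<Sum>S\<in>?L. C\<^sup>2 * 2 ^ k * real n ^ (k + i) * T S)"
    by (rule sum_mono)
  then have sum: "real (m choose i) * A \<le> C\<^sup>2 * 2 ^ k * real n ^ (k + i) * (\<Sum>S\<in>?L. T S)"
    by (simp add: n_subsets sum_distrib_left)
  have "real n ^ i * A \<le> (3 * real k) ^ k * real (m choose i) * A"
    unfolding m by (intro mult_right_mono power_le_binomial_half i n A0)
  also have "\<dots> \<le> (3 * real k) ^ k * (C\<^sup>2 * 2 ^ k * real n ^ (k + i) * (\<Sum>S\<in>?L. T S))"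
    unfolding mult.assoc[of _ "real (m choose i)"] by (intro mult_left_mono sum) auto
  also have "\<dots> = real n ^ i * (C\<^sup>2 * 2 ^ k * (3 * real k) ^ k * real n ^ k * (\<Sum>S\<in>?L. T S))"
    by (simp add: power_add)
  finally have "A \<le> C\<^sup>2 * 2 ^ k * (3 * real k) ^ k * real n ^ k * (\<Sum>S\<in>?L. T S)"
    using n0 by simp
  also have "(\<Sum>S\<in>?L. T S) = (\<Sum>\<sigma>\<in>?P. \<Sum>S\<in>?L. \<Sum>\<beta>\<in>?P. \<bar>walsh_coeff {1..m} (cross n k m w u \<sigma> \<beta>) S\<bar>)"
    unfolding T_def by (rule sum.swap)
  also have "\<dots> = (\<Sum>\<sigma>\<in>?P. \<Sum>\<beta>\<in>?P. level_sum n k m w u i \<sigma> \<beta>)"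
    unfolding level_sum_def by (rule sum.cong[OF refl]) (rule sum.swap)
  finally show ?thesis by (simp add: A_def)
qed

text \<open>The first-moment bound is applied for each \<open>\<sigma>\<close> and
  \<open>\<beta>\<close>. For fixed \<open>\<sigma>\<close> and \<open>e\<close> the composed
  permutation runs over all permutations as \<open>\<beta>\<close> varies, so the average over
  \<open>e\<close> disappears.\<close>

lemma sum_level_sum_le_exp:
  assumes m: "m = n div 2"
  shows "(\<Sum>\<sigma> | \<sigma> permutes {1..n}. \<Sum>\<beta> | \<beta> permutes {1..n}. level_sum n k m w u i \<sigma> \<beta>)
    \<le> sqrt (real n) ^ i * 3 ^ Suc k * ((fact n)\<^sup>2 * exp_abs_inner n k w u)"
proof -
  let ?P = "{\<sigma>. \<sigma> permutes {1..n}}"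
  define Y where "Y = (\<lambda>\<pi>. \<bar>hinner n k (hperm \<pi> w) u\<bar>)"
  have m2: "2 * m \<le> n" and mn: "m \<le> n" unfolding m by linarith+
  have lev: "2 ^ m * level_sum n k m w u i \<sigma> \<beta> \<le>
      sqrt (real n) ^ i * 3 ^ Suc k * (\<Sum>e\<in>Pow {1..m}. Y (\<beta> \<circ> (pair_swap m e \<circ> inv \<sigma>)))"
    if "\<sigma> \<in> ?P" "\<beta> \<in> ?P" for \<sigma> \<beta>
  proof -
    have "2 ^ m * level_sum n k m w u i \<sigma> \<beta> \<le> sqrt (real n) ^ i * 3 ^ Suc k *
        (\<Sum>e\<in>Pow {1..m}. \<bar>wpoly {1..m} (walsh_coeff {1..m} (cross n k m w u \<sigma> \<beta>)) e\<bar>)"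
    proof -
      have "2 ^ card {1..m} * level_sum n k m w u i \<sigma> \<beta> \<le> sqrt (real n) ^ i * 3 ^ Suc k *
          (\<Sum>e\<in>Pow {1..m}. \<bar>wpoly {1..m} (walsh_coeff {1..m} (cross n k m w u \<sigma> \<beta>)) e\<bar>)"
        unfolding level_sum_def
        by (rule first_moment_wpoly_level) (simp, use mn in simp, rule cross_coeff_high)
      then show ?thesis by simp
    qed
    also have "(\<Sum>e\<in>Pow {1..m}. \<bar>wpoly {1..m} (walsh_coeff {1..m} (cross n k m w u \<sigma> \<beta>)) e\<bar>)
        = (\<Sum>e\<in>Pow {1..m}. Y (\<beta> \<circ> (pair_swap m e \<circ> inv \<sigma>)))"
      using that m2 by (intro sum.cong refl) (simp add: wpoly_walsh_coeff hinner_eq_cross Y_def)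
    finally show ?thesis .
  qed
  have fib: "(\<Sum>\<beta>\<in>?P. Y (\<beta> \<circ> (pair_swap m e \<circ> inv \<sigma>))) = fact n * exp_abs_inner n k w u" if "\<sigma> \<in> ?P" for \<sigma> e
  proof -
    have "(pair_swap m e \<circ> inv \<sigma>) permutes {1..n}"
      using that m2 by (intro permutes_compose permutes_inv pair_swap_permutes) auto
    then have "(\<Sum>\<beta>\<in>?P. Y (\<beta> \<circ> (pair_swap m e \<circ> inv \<sigma>))) = (\<Sum>\<beta>\<in>?P. Y \<beta>)"
      by (rule sum_permutes_right)
    then show ?thesis by (simp add: exp_abs_inner_def Y_def)
  qed
  have "2 ^ m * (\<Sum>\<sigma>\<in>?P. \<Sum>\<beta>\<in>?P. level_sum n k m w u i \<sigma> \<beta>)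
      = (\<Sum>\<sigma>\<in>?P. \<Sum>\<beta>\<in>?P. 2 ^ m * level_sum n k m w u i \<sigma> \<beta>)"
    by (simp only: sum_distrib_left)
  also have "\<dots> \<le> (\<Sum>\<sigma>\<in>?P. \<Sum>\<beta>\<in>?P. sqrt (real n) ^ i * 3 ^ Suc k *
      (\<Sum>e\<in>Pow {1..m}. Y (\<beta> \<circ> (pair_swap m e \<circ> inv \<sigma>))))"
    by (intro sum_mono lev)
  also have "\<dots> = sqrt (real n) ^ i * 3 ^ Suc k *
      (\<Sum>\<sigma>\<in>?P. \<Sum>\<beta>\<in>?P. \<Sum>e\<in>Pow {1..m}. Y (\<beta> \<circ> (pair_swap m e \<circ> inv \<sigma>)))"
    by (simp only: sum_distrib_left)
  also have "(\<Sum>\<sigma>\<in>?P. \<Sum>\<beta>\<in>?P. \<Sum>e\<in>Pow {1..m}. Y (\<beta> \<circ> (pair_swap m e \<circ> inv \<sigma>)))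
      = (\<Sum>\<sigma>\<in>?P. \<Sum>e\<in>Pow {1..m}. \<Sum>\<beta>\<in>?P. Y (\<beta> \<circ> (pair_swap m e \<circ> inv \<sigma>)))"
    by (rule sum.cong[OF refl]) (rule sum.swap)
  also have "\<dots> = (\<Sum>\<sigma>\<in>?P. \<Sum>e\<in>Pow {1..m}. fact n * exp_abs_inner n k w u)"
    by (rule sum.cong[OF refl], rule sum.cong[OF refl], rule fib)
  also have "\<dots> = 2 ^ m * ((fact n)\<^sup>2 * exp_abs_inner n k w u)"
    by (simp add: card_Pow card_permutations power2_eq_square)
  finally show ?thesis by simp
qed

lemma abs_hinner_le_disc:
  assumes "\<pi> permutes {1..n}" "hweight k w {1..n} = 0"
  shows "\<bar>hinner n k (hperm \<pi> w) u\<bar> \<le> disc n k w u"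
proof -
  have "\<bar>hinner n k (hperm \<pi> w) u - hdensity n k w * hdensity n k u * real (n choose k)\<bar> \<le> disc n k w u"
    unfolding disc_def using assms(1) by (intro Max_ge) (auto simp: finite_permutations)
  moreover have "hdensity n k w = 0"
    by (simp only: hdensity_def assms(2) div_0)
  ultimately show ?thesis by simp
qed

text \<open>Each value of the polynomial is the inner product for some permutation, so the
  discrepancy bounds its maximum. Level \<open>i\<close> is level \<open>Suc (i - 1)\<close> in the
  supremum bound, which gives the exponent \<open>i - 1\<close>.\<close>

lemma level_sum_le_disc:
  "\<exists>C>0. \<forall>n w u i \<sigma> \<beta>. 1 \<le> i \<longrightarrow> i \<le> k \<longrightarrow> hweight k w {1..n} = 0 \<longrightarrow>
    \<sigma> permutes {1..n} \<longrightarrow> \<beta> permutes {1..n} \<longrightarrow>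
    level_sum n k (n div 2) w u i \<sigma> \<beta> \<le> C * sqrt (real n) ^ (i - 1) * disc n k w u"
proof -
  obtain C where C: "C > 0" "\<forall>(M::nat set) n c B i. finite M \<longrightarrow> card M \<le> n \<longrightarrow> (\<forall>S\<subseteq>M. k < card S \<longrightarrow> c S = 0) \<longrightarrow>
    (\<forall>e\<subseteq>M. \<bar>wpoly M c e\<bar> \<le> B) \<longrightarrow> i \<le> k \<longrightarrow>
    (\<Sum>S | S \<subseteq> M \<and> card S = Suc i. \<bar>c S\<bar>) \<le> C * sqrt (real n) ^ i * B"
    using level_sum_le_sup[where 'a = nat, of k] by blast
  show ?thesis
  proof (intro exI[of _ C] conjI allI impI)
    fix n w u i \<sigma> \<beta>
    assume i: "1 \<le> i" "i \<le> k" and w: "hweight k w {1..n} = 0" and p: "\<sigma> permutes {1..n}" "\<beta> permutes {1..n}"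
    define m where "m = n div 2"
    define c where "c = walsh_coeff {1..m} (cross n k m w u \<sigma> \<beta>)"
    have m2: "2 * m \<le> n" by (simp add: m_def)
    have "\<bar>wpoly {1..m} c e\<bar> \<le> disc n k w u" if "e \<subseteq> {1..m}" for e
    proof -
      have "(\<beta> \<circ> (pair_swap m e \<circ> inv \<sigma>)) permutes {1..n}"
        using p m2 by (intro permutes_compose permutes_inv pair_swap_permutes)
      from abs_hinner_le_disc[OF this w] show ?thesis
        unfolding hinner_eq_cross[OF p m2] c_def using that by (simp add: wpoly_walsh_coeff)
    qed
    moreover have "c S = 0" if "S \<subseteq> {1..m}" "k < card S" for S
      unfolding c_def using that by (rule cross_coeff_high)
    ultimately have "(\<Sum>S | S \<subseteq> {1..m} \<and> card S = Suc (i - 1). \<bar>c S\<bar>) \<le> C * sqrt (real n) ^ (i - 1) * disc n k w u"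
      using i m2 by (intro C(2)[rule_format]) auto
    then show "level_sum n k (n div 2) w u i \<sigma> \<beta> \<le> C * sqrt (real n) ^ (i - 1) * disc n k w u"
      using i by (simp add: level_sum_def c_def m_def)
  qed (rule C(1))
qed

lemma powr_half_add:
  assumes "n > 0"
  shows "real n powr (real i / 2 + real k) = sqrt (real n) ^ i * real n ^ k"
  using assms by (simp add: powr_add powr_realpow flip: powr_half_sqrt powr_powr) (simp add: powr_realpow' powr_powr flip: powr_realpow)

theorem theorem5p1:
  shows "\<forall>k::nat. k \<ge> 1 \<longrightarrow>
    (\<exists>c1 c2 :: real. c1 > 0 \<and> c2 > 0 \<and>
      (\<forall>n::nat. n \<ge> 2 * k \<longrightarrow>
        (\<forall>F :: (nat set \<Rightarrow> real) set.
           (\<forall>w\<in>F. is_whyp n k w \<and> hweight k w {1..n} = 0) \<longrightarrow>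
           (\<exists>part :: (nat set \<Rightarrow> real) \<Rightarrow> nat.
              (\<forall>w\<in>F. part w \<in> {1..k}) \<and>
              (\<forall>i\<in>{1..k}. \<forall>w\<in>F. \<forall>u\<in>F.
                 part w = i \<and> part u = i \<and> w \<noteq> u \<longrightarrow>
                 disc n k w u \<ge> c1 * hnorm1 n k w * hnorm1 n k u
                     / real n powr (real i / 2 - 1 / 2 + real k) \<and>
                 exp_abs_inner n k w u \<ge> c2 * hnorm1 n k w * hnorm1 n k u
                     / real n powr (real i / 2 + real k))))))"
proof (intro allI impI)
  fix k :: nat assume k: "1 \<le> k"
  \<comment> \<open>\<open>C\<close> is the loss in passing from a norm to its largest pattern norm,
    and \<open>K\<close> is the constant of \<open>hnorm1_mult_le_level_sum\<close> for this
    \<open>C\<close>.\<close>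
  define C where "C = 2 ^ k * real k ^ (2 * k)"
  define K where "K = C\<^sup>2 * 2 ^ k * (3 * real k) ^ k"
  have C: "C > 0" and K: "K > 0" using k by (auto simp: C_def K_def)
  obtain D where D: "D > 0" "\<And>n w u i \<sigma> \<beta>. 1 \<le> i \<Longrightarrow> i \<le> k \<Longrightarrow> hweight k w {1..n} = 0 \<Longrightarrow>
    \<sigma> permutes {1..n} \<Longrightarrow> \<beta> permutes {1..n} \<Longrightarrow>
    level_sum n k (n div 2) w u i \<sigma> \<beta> \<le> D * sqrt (real n) ^ (i - 1) * disc n k w u"
    using level_sum_le_disc[of k] by blast
  show "\<exists>c1 c2 :: real. c1 > 0 \<and> c2 > 0 \<and>
      (\<forall>n::nat. n \<ge> 2 * k \<longrightarrow>
        (\<forall>F :: (nat set \<Rightarrow> real) set.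
           (\<forall>w\<in>F. is_whyp n k w \<and> hweight k w {1..n} = 0) \<longrightarrow>
           (\<exists>part :: (nat set \<Rightarrow> real) \<Rightarrow> nat.
              (\<forall>w\<in>F. part w \<in> {1..k}) \<and>
              (\<forall>i\<in>{1..k}. \<forall>w\<in>F. \<forall>u\<in>F.
                 part w = i \<and> part u = i \<and> w \<noteq> u \<longrightarrow>
                 disc n k w u \<ge> c1 * hnorm1 n k w * hnorm1 n k u
                     / real n powr (real i / 2 - 1 / 2 + real k) \<and>
                 exp_abs_inner n k w u \<ge> c2 * hnorm1 n k w * hnorm1 n k u
                     / real n powr (real i / 2 + real k)))))"
  proof (rule exI[of _ "1 / (K * D)"], rule exI[of _ "1 / (K * 3 ^ Suc k)"], intro conjI allI impI)
    fix n :: nat and F :: "(nat set \<Rightarrow> real) set"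
    assume n: "2 * k \<le> n" and F: "\<forall>w\<in>F. is_whyp n k w \<and> hweight k w {1..n} = 0"
    define m where "m = n div 2"
    have m: "k \<le> m" "2 * m \<le> n" and n0: "n > 0" using n k by (auto simp: m_def)
    \<comment> \<open>The condition involves \<open>w\<close> alone, so choosing one good index for
      each hypergraph gives a partition.\<close>
    define good where "good = (\<lambda>w i. i \<in> {1..k} \<and> (\<forall>S. S \<subseteq> {1..m} \<longrightarrow> card S = i \<longrightarrow>
      fact n * hnorm1 n k w \<le> C * real n ^ i * pattern_norm n k m S {} w))"
    have ex: "\<exists>i. good w i" if "w \<in> F" for w
    proof -
      have "hweight k w {1..n} = 0" using F that by blast
      from exists_large_pattern_norm[OF k m this] show ?thesis
        unfolding good_def C_def by metis
    qed
    define part where "part = (\<lambda>w. SOME i. good w i)"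
    have part: "good w (part w)" if "w \<in> F" for w
      unfolding part_def by (rule someI_ex) (rule ex[OF that])
    show "\<exists>part :: (nat set \<Rightarrow> real) \<Rightarrow> nat.
              (\<forall>w\<in>F. part w \<in> {1..k}) \<and>
              (\<forall>i\<in>{1..k}. \<forall>w\<in>F. \<forall>u\<in>F.
                 part w = i \<and> part u = i \<and> w \<noteq> u \<longrightarrow>
                 disc n k w u \<ge> 1 / (K * D) * hnorm1 n k w * hnorm1 n k u
                     / real n powr (real i / 2 - 1 / 2 + real k) \<and>
                 exp_abs_inner n k w u \<ge> 1 / (K * 3 ^ Suc k) * hnorm1 n k w * hnorm1 n k u
                     / real n powr (real i / 2 + real k))"
    proof (intro exI[of _ part] conjI ballI impI)
      show "part w \<in> {1..k}" if "w \<in> F" for w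
        using part[OF that] by (simp add: good_def)
    next
      fix i w u
      assume i: "i \<in> {1..k}" and wu: "w \<in> F" "u \<in> F" and eq: "part w = i \<and> part u = i \<and> w \<noteq> u"
      have i': "1 \<le> i" "i \<le> k" using i by auto
      define L where "L = (\<Sum>\<sigma> | \<sigma> permutes {1..n}. \<Sum>\<beta> | \<beta> permutes {1..n}. level_sum n k m w u i \<sigma> \<beta>)"
      have main: "(fact n)\<^sup>2 * (hnorm1 n k w * hnorm1 n k u) \<le> K * real n ^ k * L"
        unfolding K_def L_def
        by (rule hnorm1_mult_le_level_sum[OF i' n m_def])
          (use C part[OF wu(1)] part[OF wu(2)] eq in \<open>auto simp: good_def\<close>)
      \<comment> \<open>Both conclusions bound \<open>L\<close> by \<open>(fact n)\<^sup>2\<close>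
        times a multiple of the wanted quantity; this cancels the number of pairs of
        permutations.\<close>
      have bound: "hnorm1 n k w * hnorm1 n k u \<le> K * real n ^ k * z" if "L \<le> (fact n)\<^sup>2 * z" for z
      proof -
        have "K * real n ^ k * L \<le> K * real n ^ k * ((fact n)\<^sup>2 * z)"
          using that K by (intro mult_left_mono) auto
        with main have "(fact n)\<^sup>2 * (hnorm1 n k w * hnorm1 n k u) \<le> K * real n ^ k * ((fact n)\<^sup>2 * z)"
          by (rule order_trans)
        also have "\<dots> = (fact n)\<^sup>2 * (K * real n ^ k * z)" by simp
        finally show ?thesis by (rule mult_left_le_imp_le) simp
      qed
      have pos: "sqrt (real n) > 0" "real n > 0" using n0 by auto
      have "L \<le> (fact n)\<^sup>2 * (sqrt (real n) ^ i * 3 ^ Suc k * exp_abs_inner n k w u)"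
        using sum_level_sum_le_exp[OF m_def, of k w u i] unfolding L_def by (simp add: mult_ac)
      from bound[OF this]
      show "exp_abs_inner n k w u \<ge> 1 / (K * 3 ^ Suc k) * hnorm1 n k w * hnorm1 n k u
                     / real n powr (real i / 2 + real k)"
        unfolding powr_half_add[OF n0] using K pos by (simp add: divide_le_eq mult_ac)
      have "L \<le> (\<Sum>\<sigma> | \<sigma> permutes {1..n}. \<Sum>\<beta> | \<beta> permutes {1..n}. D * sqrt (real n) ^ (i - 1) * disc n k w u)"
        unfolding L_def m_def using F wu by (intro sum_mono D(2) i') auto
      also have "\<dots> = (fact n)\<^sup>2 * (D * sqrt (real n) ^ (i - 1) * disc n k w u)"
        by (simp add: card_permutations power2_eq_square)
      finally have d: "hnorm1 n k w * hnorm1 n k u \<le> K * real n ^ k * (D * sqrt (real n) ^ (i - 1) * disc n k w u)"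
        by (rule bound)
      \<comment> \<open>The exponent becomes that of \<open>powr_half_add\<close> at
        \<open>i - 1\<close>; the natural subtraction is exact because
        \<open>1 \<le> i\<close>.\<close>
      have "real i / 2 - 1 / 2 = real (i - 1) / 2"
        using i' by (simp add: of_nat_diff field_simps)
      with d show "disc n k w u \<ge> 1 / (K * D) * hnorm1 n k w * hnorm1 n k u
                     / real n powr (real i / 2 - 1 / 2 + real k)"
        using K D(1) pos by (simp only: powr_half_add[OF n0]) (simp add: divide_le_eq mult_ac)
    qed
  qed (use K D(1) in auto)
qed

end
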